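(* Let $\boldsymbol{X}=(X_1,\dots,X_d)$ be an HT-HSCM with tail index $\alpha$ on a DAG $\mathcal{D}=(V,E)$, $V=\{1,\dots,d\}$, with standardized CTC matrix $\boldsymbol{\Gamma}^*=(\Gamma^*_{ij})_{i,j=1}^d$ and standardized AIR matrix $\widetilde{F}=(\widetilde{F}_{ij})_{i,j=1}^d$. Consider the following algorithm with input $\boldsymbol{\Gamma}^*$: For $\nu=0,1,\dots,d-1$, and for each $j\in V$ with $|an(j)|=\nu$: - for each $i\in V\setminus De(j)$, set $\widetilde{F}_{ji}\leftarrow 0$; - for each $i\in De(j)$, set $\widetilde{F}_{ji}\leftarrow \Gamma^*_{ij}-\sum_{k\in an(j)}\widetilde{F}_{ki}$. Then this algorithm correctly recovers the standardized AIR matrix $\widetilde{F}$ from the standardized CTC matrix $\boldsymbol{\Gamma}^*$.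
   Context: **Graphs.** $\mathcal{D}=(V,E)$ is a directed acyclic graph (DAG) with $V=\{1,\dots,d\}$; $pa(i)=\{j\in V:(j,i)\in E\}$. The set $an(i)$ of ancestors of $i$ is the set of nodes $j$ for which there is a directed path (with at least one edge) from $j$ to $i$, and $An(i)=an(i)\cup\{i\}$. The set $de(j)$ of descendants of $j$ is the set of nodes $i$ with $j\in an(i)$, and $De(j)=de(j)\cup\{j\}$. **HT-HSCM.** A Heavy-Tailed Homogeneous Structural Causal Model on $\mathcal{D}$ is a random vector $\boldsymbol{X}=(X_1,\dots,X_d)$ satisfying $X_i=f_{pa(i)}(\boldsymbol{X}_{pa(i)},\varepsilon_i)$, $i=1,\dots,d$, where $\boldsymbol{X}_{pa(i)}=(X_j)_{j\in pa(i)}$ and: - $\varepsilon_1,\dots,\varepsilon_d$ are i.i.d. non-negative random variables, regularly varying with tail index $\alpha>0$: $\mathbb{P}(\varepsilon_i>x)\sim \ell(x)x^{-\alpha}$ as $x\to\infty$, for a slowly varying function $\ell$; - each $f_{pa(i)}:\mathbb{R}_+^{|pa(i)|+1}\to\mathbb{R}_+$ (with $\mathbb{R}_+=[0,\infty)$) is non-negative; satisfies $f_{pa(i)}(x)=0\iff x=0$; is continuous; is homogeneous of degree 1, i.e. $f_{pa(i)}(cx)=cf_{pa(i)}(x)$ for all $c>0$ and all $x$; and satisfies coordinate deletion monotonicity: $f_{pa(i)}(x)\ge f_{pa(i)}\big(\sum_{j\in J}x_j\mathbf{e}_j\big)$ for every $x$ in the domain and every nonempty $J\subseteq\{1,\dots,|pa(i)|+1\}$,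 where $\mathbf{e}_j$ are the standard basis vectors; - the marginal distribution of each $X_i$ is continuous. **AIR matrices.** Recursively substituting the structural equations along the DAG expresses $X_i=F_{An(i)}(\boldsymbol{\varepsilon}_{An(i)})$, where $\boldsymbol{\varepsilon}_{An(i)}=(\varepsilon_h)_{h\in An(i)}$ and $F_{An(i)}:\mathbb{R}_+^{|An(i)|}\to\mathbb{R}_+$ is the resulting composite function. The ancestral impulse-response (AIR) matrix $F\in\mathbb{R}^{d\times d}$ is $F_{hi}=F_{An(i)}\big((\mathbf{1}_{\{j=h\}})_{j\in An(i)}\big)$ if $h\in An(i)$, and $F_{hi}=0$ otherwise. The standardized AIR matrix $\widetilde{F}\in\mathbb{R}^{d\times d}$ is $\widetilde{F}_{hi}=F_{hi}\big/\big(\sum_{k\in An(i)}F_{ki}^\alpha\big)^{1/\alpha}$. **Standardized causal tail coefficient (CTC) matrix.** Let $G_i$ be the cumulative distribution function of $X_i$. For $i,j\in V$, $\Gamma^*_{ji}=\lim_{x\to\infty}\mathbb{E}[2G_i(X_i)-1\mid X_j>x]$ (these limits exist), and $\boldsymbol{\Gamma}^*=(\Gamma^*_{ij})_{i,j=1}^d$. **Ancestor sets.** The ancestor sets used by the algorithm (and hence the cardinalities $|an(j)|$ and the sets $De(j)$) are identified from $\boldsymbol{\Gamma}^*$ through $an(j)=\{i\in V\setminus\{j\}:\Gamma^*_{ij}=1\}$.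
   Formalization: The claim fails for α≠1 (X1=ε1, X2=X1+ε2, α=2: the algorithm gives 1/2, not 2^(-1/2)); proved instead: the algorithm's output is the entrywise α-th power of the standardized AIR matrix, whose α-th root recovers it, with equality when α=1. *)

theory Defs
  imports "HOL-Probability.Probability"
begin

section \<open>Graphs\<close>

definition parents :: "(nat \<times> nat) set \<Rightarrow> nat \<Rightarrow> nat set" where
  "parents E i = {j. (j, i) \<in> E}"

definition ancestors :: "(nat \<times> nat) set \<Rightarrow> nat \<Rightarrow> nat set" where
  "ancestors E i = {j. (j, i) \<in> E\<^sup>+}"

definition Ancestors :: "(nat \<times> nat) set \<Rightarrow> nat \<Rightarrow> nat set" where
  "Ancestors E i = insert i (ancestors E i)"

section \<open>Structural functions\<close>

text \<open>
  A vector in the non-negative orthant with coordinates indexed by a finite set \<open>S\<close> is represented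
  by its extension by zero outside \<open>S\<close>. On this set the (product) topology of the function space is
  the Euclidean topology of the orthant.
\<close>

definition orthant :: "nat set \<Rightarrow> (nat \<Rightarrow> real) set" where
  "orthant S = {x. (\<forall>j\<in>S. 0 \<le> x j) \<and> (\<forall>j. j \<notin> S \<longrightarrow> x j = 0)}"

definition unit_vec :: "nat \<Rightarrow> nat \<Rightarrow> real" where
  "unit_vec h = (\<lambda>j. if j = h then 1 else 0)"

definition structural_function :: "nat set \<Rightarrow> ((nat \<Rightarrow> real) \<Rightarrow> real) \<Rightarrow> bool" where
  "structural_function S g \<longleftrightarrow>
     (\<forall>x\<in>orthant S. 0 \<le> g x) \<and>
     (\<forall>x\<in>orthant S. g x = 0 \<longleftrightarrow> x = (\<lambda>_. 0)) \<and>
     continuous_on (orthant S) g \<and>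
     (\<forall>x\<in>orthant S. \<forall>c>0. g (\<lambda>j. c * x j) = c * g x) \<and>
     (\<forall>x\<in>orthant S. \<forall>J. J \<noteq> {} \<and> J \<subseteq> S \<longrightarrow>
        g (\<lambda>l. \<Sum>j\<in>J. x j * unit_vec j l) \<le> g x)"

text \<open>
  The arguments of the structural function of node \<open>i\<close> are indexed by \<open>insert i (parents E i)\<close>.
  In an acyclic graph \<open>i\<close> is not one of its own parents, so coordinate \<open>i\<close> is free to carry the
  noise variable of node \<open>i\<close>.
\<close>

definition node_input :: "(nat \<times> nat) set \<Rightarrow> nat \<Rightarrow> (nat \<Rightarrow> real) \<Rightarrow> real \<Rightarrow> nat \<Rightarrow> real" where
  "node_input E i y e = (\<lambda>j. if j = i then e else if j \<in> parents E i then y j else 0)"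

text \<open>
  Recursive substitution of the structural equations: \<open>composite E f i\<close>, restricted to
  \<open>orthant (Ancestors E i)\<close>, is the function expressing node \<open>i\<close> through the noise variables of
  \<open>Ancestors E i\<close>. The recursion is well-founded when \<open>E\<close> is finite and acyclic.
\<close>

definition composite ::
  "(nat \<times> nat) set \<Rightarrow> (nat \<Rightarrow> (nat \<Rightarrow> real) \<Rightarrow> real) \<Rightarrow> nat \<Rightarrow> (nat \<Rightarrow> real) \<Rightarrow> real" where
  "composite E f i e = wfrec E (\<lambda>F k. f k (node_input E k F (e k))) i"

lemma composite_unfold:
  assumes "finite E" "acyclic E"
  shows "composite E f i e = f i (node_input E i (\<lambda>j. composite E f j e) (e i))"
proof -
  have "node_input E i (cut F E i) a = node_input E i F a" for F a
    by (auto simp: node_input_def parents_def cut_def)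
  moreover have "(\<lambda>j. composite E f j e) = wfrec E (\<lambda>F k. f k (node_input E k F (e k)))"
    by (simp add: composite_def fun_eq_iff)
  ultimately show ?thesis
    using wfrec[OF finite_acyclic_wf[OF assms], of "\<lambda>F k. f k (node_input E k F (e k))" i]
    by (simp only: composite_def)
qed

lemma composite_cong:
  assumes "finite E" "acyclic E" "\<And>h. h \<in> Ancestors E i \<Longrightarrow> e h = e' h"
  shows "composite E f i e = composite E f i e'"
  using assms(3)
proof (induction i rule: wf_induct_rule[OF finite_acyclic_wf[OF assms(1,2)]])
  case (1 i)
  have "composite E f j e = composite E f j e'" if "j \<in> parents E i" for j
  proof (rule 1)
    show "(j, i) \<in> E" using that by (simp add: parents_def)
    then show "e h = e' h" if "h \<in> Ancestors E j" for h
      using that 1(2) by (auto simp: Ancestors_def ancestors_def intro: trancl_into_trancl)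
  qed
  moreover have "e i = e' i"
    using 1(2) by (simp add: Ancestors_def)
  ultimately have "node_input E i (\<lambda>j. composite E f j e) (e i) =
      node_input E i (\<lambda>j. composite E f j e') (e' i)"
    by (auto simp: node_input_def fun_eq_iff)
  then show ?case
    by (simp add: composite_unfold[OF assms(1,2), of f i])
qed

section \<open>Heavy-tailed homogeneous structural causal models\<close>

definition slowly_varying :: "(real \<Rightarrow> real) \<Rightarrow> bool" where
  "slowly_varying l \<longleftrightarrow> l \<in> borel_measurable borel \<and> eventually (\<lambda>x. 0 < l x) at_top \<and>
     (\<forall>c>0. ((\<lambda>x. l (c * x) / l x) \<longlongrightarrow> 1) at_top)"

locale ht_hscm = prob_space M
  for M :: "'a measure" +
  fixes d :: nat
    and E :: "(nat \<times> nat) set"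
    and f :: "nat \<Rightarrow> (nat \<Rightarrow> real) \<Rightarrow> real"
    and \<epsilon> X :: "nat \<Rightarrow> 'a \<Rightarrow> real"
    and \<alpha> :: real
  assumes edges: "E \<subseteq> {1..d} \<times> {1..d}"
    and acyclic: "acyclic E"
    and tail_index_pos: "0 < \<alpha>"
    and noise_indep: "indep_vars (\<lambda>_. borel) \<epsilon> {1..d}"
    and noise_ident: "\<And>i j. i \<in> {1..d} \<Longrightarrow> j \<in> {1..d} \<Longrightarrow>
          distr M borel (\<epsilon> i) = distr M borel (\<epsilon> j)"
    and noise_nonneg: "\<And>i \<omega>. i \<in> {1..d} \<Longrightarrow> \<omega> \<in> space M \<Longrightarrow> 0 \<le> \<epsilon> i \<omega>"
    and noise_regularly_varying: "\<exists>l. slowly_varying l \<and> (\<forall>i\<in>{1..d}.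
          (\<lambda>x. prob {\<omega>\<in>space M. x < \<epsilon> i \<omega>}) \<sim>[at_top] (\<lambda>x. l x * x powr (-\<alpha>)))"
    and structural: "\<And>i. i \<in> {1..d} \<Longrightarrow> structural_function (insert i (parents E i)) (f i)"
    and X_measurable: "\<And>i. i \<in> {1..d} \<Longrightarrow> random_variable borel (X i)"
    and X_eq: "\<And>i \<omega>. i \<in> {1..d} \<Longrightarrow> \<omega> \<in> space M \<Longrightarrow>
          X i \<omega> = f i (node_input E i (\<lambda>j. X j \<omega>) (\<epsilon> i \<omega>))"
    and X_continuous: "\<And>i. i \<in> {1..d} \<Longrightarrow> continuous_on UNIV (cdf (distr M borel (X i)))"
begin

lemma X_eq_composite:
  assumes "i \<in> {1..d}" "\<omega> \<in> space M"
  shows "X i \<omega> = composite E f i (\<lambda>h. \<epsilon> h \<omega>)"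
proof -
  have fin: "finite E"
    using edges by (rule finite_subset) simp
  show ?thesis
    using assms(1)
  proof (induction i rule: wf_induct_rule[OF finite_acyclic_wf[OF fin acyclic]])
    case (1 i)
    have "X j \<omega> = composite E f j (\<lambda>h. \<epsilon> h \<omega>)" if "j \<in> parents E i" for j
      using that edges by (intro 1) (auto simp: parents_def)
    then have "node_input E i (\<lambda>j. X j \<omega>) (\<epsilon> i \<omega>) =
        node_input E i (\<lambda>j. composite E f j (\<lambda>h. \<epsilon> h \<omega>)) (\<epsilon> i \<omega>)"
      by (auto simp: node_input_def fun_eq_iff)
    then show ?case
      using X_eq[OF 1(2) assms(2)] composite_unfold[OF fin acyclic, of f i] by simp
  qed
qed

end

section \<open>AIR and CTC matrices\<close>

definition air_matrix ::
  "(nat \<times> nat) set \<Rightarrow> (nat \<Rightarrow> (nat \<Rightarrow> real) \<Rightarrow> real) \<Rightarrow> nat \<Rightarrow> nat \<Rightarrow> real" where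
  "air_matrix E f h i = (if h \<in> Ancestors E i then composite E f i (unit_vec h) else 0)"

definition std_air_matrix ::
  "(nat \<times> nat) set \<Rightarrow> (nat \<Rightarrow> (nat \<Rightarrow> real) \<Rightarrow> real) \<Rightarrow> real \<Rightarrow> nat \<Rightarrow> nat \<Rightarrow> real" where
  "std_air_matrix E f \<alpha> h i =
     air_matrix E f h i / (\<Sum>k\<in>Ancestors E i. air_matrix E f k i powr \<alpha>) powr (1 / \<alpha>)"

text \<open>The row index is the conditioning variable, the column index the averaged one.\<close>

definition ctc_matrix :: "'a measure \<Rightarrow> (nat \<Rightarrow> 'a \<Rightarrow> real) \<Rightarrow> nat \<Rightarrow> nat \<Rightarrow> real" where
  "ctc_matrix M X j i =
     Lim at_top (\<lambda>x. \<integral>\<omega>. 2 * cdf (distr M borel (X i)) (X i \<omega>) - 1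
                      \<partial>uniform_measure M {\<omega>\<in>space M. x < X j \<omega>})"

section \<open>The algorithm\<close>

text \<open>The ancestral relations used by the algorithm are read off from its input matrix \<open>\<Gamma>\<close>.\<close>

definition ctc_ancestors :: "nat \<Rightarrow> (nat \<Rightarrow> nat \<Rightarrow> real) \<Rightarrow> nat \<Rightarrow> nat set" where
  "ctc_ancestors d \<Gamma> j = {i \<in> {1..d} - {j}. \<Gamma> i j = 1}"

definition ctc_Descendants :: "nat \<Rightarrow> (nat \<Rightarrow> nat \<Rightarrow> real) \<Rightarrow> nat \<Rightarrow> nat set" where
  "ctc_Descendants d \<Gamma> j = insert j {i \<in> {1..d}. j \<in> ctc_ancestors d \<Gamma> i}"

text \<open>
  All entries of row \<open>j\<close> are assigned at once: the right-hand sides only read rows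
  \<open>k \<in> ctc_ancestors d \<Gamma> j\<close>, which do not include row \<open>j\<close>.
\<close>

definition air_row_update ::
  "nat \<Rightarrow> (nat \<Rightarrow> nat \<Rightarrow> real) \<Rightarrow> nat \<Rightarrow> (nat \<Rightarrow> nat \<Rightarrow> real) \<Rightarrow> (nat \<Rightarrow> nat \<Rightarrow> real)" where
  "air_row_update d \<Gamma> j A = A(j := (\<lambda>i.
     if i \<in> ctc_Descendants d \<Gamma> j then \<Gamma> i j - (\<Sum>k\<in>ctc_ancestors d \<Gamma> j. A k i)
     else if i \<in> {1..d} then 0
     else A j i))"

text \<open>
  \<open>A0\<close> is the content of the matrix before the first assignment, and \<open>enum \<nu>\<close> is the order in which
  the inner loop visits the nodes with exactly \<open>\<nu>\<close> ancestors.
\<close>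

definition level_enumeration :: "nat \<Rightarrow> (nat \<Rightarrow> nat \<Rightarrow> real) \<Rightarrow> (nat \<Rightarrow> nat list) \<Rightarrow> bool" where
  "level_enumeration d \<Gamma> enum \<longleftrightarrow> (\<forall>\<nu><d. distinct (enum \<nu>) \<and>
     set (enum \<nu>) = {j \<in> {1..d}. card (ctc_ancestors d \<Gamma> j) = \<nu>})"

definition air_algorithm ::
  "nat \<Rightarrow> (nat \<Rightarrow> nat list) \<Rightarrow> (nat \<Rightarrow> nat \<Rightarrow> real) \<Rightarrow> (nat \<Rightarrow> nat \<Rightarrow> real) \<Rightarrow> (nat \<Rightarrow> nat \<Rightarrow> real)"
  where
  "air_algorithm d enum A0 \<Gamma> = fold (\<lambda>\<nu>. fold (air_row_update d \<Gamma>) (enum \<nu>)) [0..<d] A0"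

text \<open>
  What this recursion computes for a general tail index \<open>\<alpha>\<close> are the \<open>\<alpha>\<close>-th powers of the entries of
  the standardized AIR matrix, since \<open>\<Gamma> i j\<close> is the sum of \<open>std_air_matrix E f \<alpha> h i powr \<alpha>\<close> over the
  common members \<open>h\<close> of \<open>Ancestors E i\<close> and \<open>Ancestors E j\<close>. For example, for \<open>X 1 = \<epsilon> 1\<close> and
  \<open>X 2 = X 1 + \<epsilon> 2\<close> the entry in position \<open>(1, 2)\<close> of the standardized AIR matrix is
  \<open>(1 / 2) powr (1 / \<alpha>)\<close>, whereas the algorithm returns \<open>\<Gamma> 2 1 = 1 / 2\<close>. Recovery therefore means
  that the output is the entrywise \<open>\<alpha>\<close>-th power of the standardized AIR matrix, so that its entrywise
  \<open>\<alpha>\<close>-th root is that matrix; for \<open>\<alpha> = 1\<close> the two matrices coincide.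
\<close>

end

theory Submission
  imports Defs
begin

text \<open>
  A sum, or more generally a homogeneous function, of independent regularly varying variables is large
  because a single one of them is. Hence, given \<open>X i > x\<close> with \<open>x\<close> large, exactly one noise variable
  \<open>\<epsilon> h\<close> with \<open>h \<in> Ancestors E i\<close> is large, with probability tending to
  \<open>std_air_matrix E f \<alpha> h i powr \<alpha>\<close>. If \<open>h \<in> Ancestors E j\<close> then \<open>X j\<close> is large as well and
  \<open>2 * G j (X j) - 1\<close> tends to 1; otherwise \<open>X j\<close> is not affected, and \<open>2 * G j (X j) - 1\<close> has mean 0
  because \<open>G j (X j)\<close> is uniform. So \<open>\<Gamma> i j\<close> is the sum of these weights over the common ancestors
  of \<open>i\<close> and \<open>j\<close>. As the weights over \<open>Ancestors E i\<close> are positive and add up to 1, \<open>\<Gamma> i j = 1\<close> holds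
  exactly for \<open>i \<in> Ancestors E j\<close>; and for \<open>j \<in> Ancestors E i\<close> the sum runs over all of
  \<open>Ancestors E j\<close>, so that subtracting the rows of the proper ancestors of \<open>j\<close> leaves the weight of \<open>j\<close>.
\<close>

section \<open>Recovery from sums over common ancestors\<close>

text \<open>Isolates what the algorithm needs from the probabilistic model: \<open>w h i\<close>
  stands for the limiting probability that a large value at \<open>i\<close> was caused by the noise
  at \<open>h\<close>.\<close>

locale common_ancestor_matrix =
  fixes d :: nat and E :: "(nat \<times> nat) set" and w \<Gamma> :: "nat \<Rightarrow> nat \<Rightarrow> real"
  assumes edges: "E \<subseteq> {1..d} \<times> {1..d}"
    and acyclic: "acyclic E"
    and weight_pos: "\<And>h i. i \<in> {1..d} \<Longrightarrow> h \<in> Ancestors E i \<Longrightarrow> 0 < w h i"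
    and weight_eq_0: "\<And>h i. i \<in> {1..d} \<Longrightarrow> h \<notin> Ancestors E i \<Longrightarrow> w h i = 0"
    and weight_sum: "\<And>i. i \<in> {1..d} \<Longrightarrow> (\<Sum>h\<in>Ancestors E i. w h i) = 1"
    and \<Gamma>_eq: "\<And>i j. i \<in> {1..d} \<Longrightarrow> j \<in> {1..d} \<Longrightarrow>
      \<Gamma> i j = (\<Sum>h\<in>Ancestors E i \<inter> Ancestors E j. w h i)"
begin

section \<open>Ancestor sets recovered from the matrix\<close>

lemma ancestors_subset: "ancestors E i \<subseteq> {1..d}"
  using trancl_subset_Sigma[OF edges] by (auto simp: ancestors_def)

lemma finite_Ancestors: "finite (Ancestors E i)"
  using finite_subset[OF ancestors_subset] by (simp add: Ancestors_def)

lemma ancestors_irrefl: "i \<notin> ancestors E i"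
  using acyclic by (auto simp: ancestors_def acyclic_def)

lemma Ancestors_mono: "i \<in> Ancestors E j \<Longrightarrow> Ancestors E i \<subseteq> Ancestors E j"
  by (auto simp: Ancestors_def ancestors_def)

text \<open>If \<open>i\<close> is not in \<open>Ancestors E j\<close>, the common sum loses the
  term \<open>h = i\<close>, whose weight is positive, and so falls strictly below the full sum
  1.\<close>

lemma \<Gamma>_eq_1_iff:
  assumes "i \<in> {1..d}" "j \<in> {1..d}"
  shows "\<Gamma> i j = 1 \<longleftrightarrow> i \<in> Ancestors E j"
proof
  assume "i \<in> Ancestors E j"
  then have "Ancestors E i \<inter> Ancestors E j = Ancestors E i"
    using Ancestors_mono by blast
  then show "\<Gamma> i j = 1"
    using assms weight_sum by (simp add: \<Gamma>_eq)
next
  assume 1: "\<Gamma> i j = 1"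
  show "i \<in> Ancestors E j"
  proof (rule ccontr)
    assume "i \<notin> Ancestors E j"
    then have "(\<Sum>h\<in>Ancestors E i \<inter> Ancestors E j. w h i) < (\<Sum>h\<in>Ancestors E i. w h i)"
      using weight_pos[OF assms(1)] less_imp_le[OF weight_pos[OF assms(1)]]
      by (intro sum_strict_mono2[where b = i] finite_Ancestors) (auto simp: Ancestors_def)
    then show False
      using 1 assms weight_sum by (simp add: \<Gamma>_eq)
  qed
qed

lemma ctc_ancestors_eq: "j \<in> {1..d} \<Longrightarrow> ctc_ancestors d \<Gamma> j = ancestors E j"
  using ancestors_subset[of j] ancestors_irrefl[of j] \<Gamma>_eq_1_iff
  by (auto simp: ctc_ancestors_def Ancestors_def)

lemma ctc_Descendants_iff:
  assumes "i \<in> {1..d}" "j \<in> {1..d}"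
  shows "i \<in> ctc_Descendants d \<Gamma> j \<longleftrightarrow> j \<in> Ancestors E i"
  using assms by (auto simp: ctc_Descendants_def ctc_ancestors_eq Ancestors_def)

text \<open>The invariant of the sweep: \<open>D\<close> collects the rows already finished. Columns
  outside \<open>{1..d}\<close> are excluded because the update of a node's row leaves them as they
  were.\<close>

definition correct_rows :: "nat set \<Rightarrow> (nat \<Rightarrow> nat \<Rightarrow> real) \<Rightarrow> bool" where
  "correct_rows D A \<longleftrightarrow> (\<forall>j\<in>D. \<forall>i\<in>{1..d}. A j i = w j i)"

text \<open>When \<open>j\<close> is in \<open>Ancestors E i\<close>, the common ancestors of the
  two are \<open>j\<close> and its proper ancestors. The rows of the latter are already correct, and
  subtracting them leaves \<open>w j i\<close>.\<close>

lemma correct_rows_update: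
  assumes "correct_rows D A" "j \<in> {1..d}" "ancestors E j \<subseteq> D"
  shows "correct_rows (insert j D) (air_row_update d \<Gamma> j A)"
proof -
  have "air_row_update d \<Gamma> j A j i = w j i" if i: "i \<in> {1..d}" for i
  proof (cases "j \<in> Ancestors E i")
    case True
    then have "Ancestors E i \<inter> Ancestors E j = insert j (ancestors E j)"
      using Ancestors_mono by (auto simp: Ancestors_def)
    then have "\<Gamma> i j = w j i + (\<Sum>k\<in>ancestors E j. w k i)"
      using i assms(2) ancestors_irrefl finite_subset[OF ancestors_subset]
      by (simp add: \<Gamma>_eq)
    moreover have "(\<Sum>k\<in>ancestors E j. A k i) = (\<Sum>k\<in>ancestors E j. w k i)"
      using assms i by (intro sum.cong) (auto simp: correct_rows_def)
    ultimately show ?thesis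
      using True i assms(2) by (simp add: air_row_update_def ctc_Descendants_iff ctc_ancestors_eq)
  next
    case False
    then show ?thesis
      using i assms(2) by (simp add: air_row_update_def ctc_Descendants_iff weight_eq_0)
  qed
  then show ?thesis
    using assms(1) by (auto simp: correct_rows_def air_row_update_def)
qed

text \<open>All ancestors are required to lie in the initial \<open>D\<close>, not among the rows
  finished during the fold, so the order of visits inside one level is immaterial.\<close>

lemma correct_rows_fold:
  assumes "correct_rows D A" "\<And>j. j \<in> set js \<Longrightarrow> j \<in> {1..d} \<and> ancestors E j \<subseteq> D"
  shows "correct_rows (set js \<union> D) (fold (air_row_update d \<Gamma>) js A)"
  using assms
proof (induction js arbitrary: A D)
  case (Cons j js)
  have "correct_rows (set js \<union> insert j D) (fold (air_row_update d \<Gamma>) js (air_row_update d \<Gamma> j A))"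
    using Cons.prems by (intro Cons.IH correct_rows_update) auto
  then show ?case by simp
qed simp

text \<open>Makes the levels a topological order. The inclusion is strict since \<open>k\<close>
  belongs to the larger set but is not its own ancestor.\<close>

lemma card_ancestors_less:
  assumes "k \<in> ancestors E j"
  shows "card (ancestors E k) < card (ancestors E j)"
proof (rule psubset_card_mono)
  show "ancestors E k \<subset> ancestors E j"
    using assms ancestors_irrefl[of k] by (auto simp: ancestors_def)
qed (rule finite_subset[OF ancestors_subset], simp)

lemma air_algorithm_correct:
  assumes "level_enumeration d \<Gamma> enum" "i \<in> {1..d}" "j \<in> {1..d}"
  shows "air_algorithm d enum A0 \<Gamma> j i = w j i"
proof -
  \<comment> \<open>Induction on the number of completed levels. Before the first level nothing is
    claimed, so \<open>A0\<close> can be arbitrary.\<close>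
  have "correct_rows {j \<in> {1..d}. card (ancestors E j) < n}
      (fold (\<lambda>\<nu>. fold (air_row_update d \<Gamma>) (enum \<nu>)) [0..<n] A0)" if "n \<le> d" for n
    using that
  proof (induction n)
    case 0
    show ?case by (simp add: correct_rows_def)
  next
    case (Suc n)
    let ?D = "{j \<in> {1..d}. card (ancestors E j) < n}"
    have enum: "set (enum n) = {j \<in> {1..d}. card (ancestors E j) = n}"
      using assms(1) Suc.prems ctc_ancestors_eq by (auto simp: level_enumeration_def)
    have "correct_rows (set (enum n) \<union> ?D) (fold (air_row_update d \<Gamma>) (enum n)
        (fold (\<lambda>\<nu>. fold (air_row_update d \<Gamma>) (enum \<nu>)) [0..<n] A0))"
    proof (rule correct_rows_fold)
      show "correct_rows ?D (fold (\<lambda>\<nu>. fold (air_row_update d \<Gamma>) (enum \<nu>)) [0..<n] A0)"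
        using Suc by simp
    next
      fix j assume "j \<in> set (enum n)"
      then have j: "j \<in> {1..d}" "card (ancestors E j) = n"
        unfolding enum by auto
      have "k \<in> ?D" if "k \<in> ancestors E j" for k
        using ancestors_subset[of j] card_ancestors_less[OF that] that j(2) by auto
      then show "j \<in> {1..d} \<and> ancestors E j \<subseteq> ?D"
        using j(1) by blast
    qed
    moreover have "set (enum n) \<union> ?D = {j \<in> {1..d}. card (ancestors E j) < Suc n}"
      unfolding enum by auto
    ultimately show ?case
      by simp
  qed
  \<comment> \<open>No node is its own ancestor, so level \<open>d - 1\<close> is the last that can
    be nonempty and the loop over \<open>[0..<d]\<close> reaches every row.\<close>
  moreover have "card (ancestors E j) < d"
  proof -
    have "ancestors E j \<subseteq> {1..d} - {j}"
      using ancestors_subset ancestors_irrefl by blast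
    then have "card (ancestors E j) \<le> card ({1..d} - {j})"
      by (intro card_mono) auto
    then show ?thesis
      using assms(3) by (auto simp: card_Diff_singleton_if)
  qed
  ultimately show ?thesis
    using assms(2,3) by (simp add: air_algorithm_def correct_rows_def)
qed

end

section \<open>Composite structural functions\<close>

locale homogeneous_scm =
  fixes V :: "nat set" and E :: "(nat \<times> nat) set" and f :: "nat \<Rightarrow> (nat \<Rightarrow> real) \<Rightarrow> real"
  assumes finite_V: "finite V"
    and edges: "E \<subseteq> V \<times> V"
    and acyclic: "acyclic E"
    and structural: "\<And>i. i \<in> V \<Longrightarrow> structural_function (insert i (parents E i)) (f i)"
begin

section \<open>Homogeneity, positivity and continuity of the composites\<close>

lemma finite_E: "finite E"
  using edges finite_V by (blast intro: finite_subset)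

lemmas composite_eq = composite_unfold[OF finite_E acyclic]
lemmas composite_eqI = composite_cong[OF finite_E acyclic]

lemma node_induct [consumes 1, case_names node]:
  assumes "i \<in> V" "\<And>i. i \<in> V \<Longrightarrow> (\<And>j. j \<in> parents E i \<Longrightarrow> P j) \<Longrightarrow> P i"
  shows "P i"
  using assms(1)
proof (induction i rule: wf_induct_rule[OF finite_acyclic_wf[OF finite_E acyclic]])
  case (1 i)
  then show ?case
    using edges assms(2)[of i] by (auto simp: parents_def)
qed

lemma Ancestors_subset: "i \<in> V \<Longrightarrow> Ancestors E i \<subseteq> V"
  using trancl_subset_Sigma[OF edges] by (auto simp: Ancestors_def ancestors_def)

lemma node_input_in_orthant:
  assumes "0 \<le> e" "\<And>j. j \<in> parents E i \<Longrightarrow> 0 \<le> y j"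
  shows "node_input E i y e \<in> orthant (insert i (parents E i))"
  using assms by (auto simp: node_input_def orthant_def)

lemma composite_nonneg:
  assumes "i \<in> V" "\<And>j. 0 \<le> e j"
  shows "0 \<le> composite E f i e"
  using assms(1)
proof (induction i rule: node_induct)
  case (node i)
  then show ?case
    using structural[of i] node_input_in_orthant[of "e i" i "\<lambda>j. composite E f j e"] assms(2)
    by (simp add: composite_eq[of f i] structural_function_def)
qed

lemma composite_input_in_orthant:
  assumes "i \<in> V" "\<And>j. 0 \<le> e j"
  shows "node_input E i (\<lambda>j. composite E f j e) (e i) \<in> orthant (insert i (parents E i))"
  using assms edges by (intro node_input_in_orthant composite_nonneg) (auto simp: parents_def)

lemma composite_scale:
  assumes "i \<in> V" "\<And>j. 0 \<le> e j" "0 < c"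
  shows "composite E f i (\<lambda>j. c * e j) = c * composite E f i e"
  using assms(1)
proof (induction i rule: node_induct)
  case (node i)
  let ?x = "node_input E i (\<lambda>j. composite E f j e) (e i)"
  have "node_input E i (\<lambda>j. composite E f j (\<lambda>j. c * e j)) (c * e i) = (\<lambda>j. c * ?x j)"
    using node.IH by (auto simp: node_input_def fun_eq_iff)
  moreover have "f i (\<lambda>j. c * ?x j) = c * f i ?x"
    using structural[OF node.hyps] composite_input_in_orthant[of i e] assms(2,3) node.hyps
    by (simp add: structural_function_def)
  ultimately show ?case
    by (simp add: composite_eq[of f i])
qed

text \<open>Scaling the zero vector by 2 leaves it unchanged, so the value equals its own
  double.\<close>

lemma composite_zero: "i \<in> V \<Longrightarrow> composite E f i (\<lambda>_. 0) = 0"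
  using composite_scale[of i "\<lambda>_. 0" 2] by simp

text \<open>Positive noise is passed on along a directed path: the last edge supplies a parent whose
  value is positive by induction, and \<open>f i\<close> vanishes only at the zero vector.\<close>

lemma composite_pos:
  assumes "i \<in> V" "\<And>j. 0 \<le> e j" "h \<in> Ancestors E i" "0 < e h"
  shows "0 < composite E f i e"
  using assms(1,3)
proof (induction i rule: node_induct)
  case (node i)
  let ?x = "node_input E i (\<lambda>j. composite E f j e) (e i)"
  have "\<exists>j. ?x j > 0"
  proof (cases "h = i")
    case True
    then show ?thesis
      using assms(4) by (intro exI[of _ i]) (simp add: node_input_def)
  next
    case False
    then have "(h, i) \<in> E\<^sup>+"
      using node.prems by (auto simp: Ancestors_def ancestors_def)
    then obtain j where j: "j \<in> parents E i" "h \<in> Ancestors E j"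
      by (cases rule: tranclE) (auto simp: parents_def Ancestors_def ancestors_def)
    moreover have "j \<noteq> i"
      using j acyclic by (auto simp: parents_def acyclic_def)
    ultimately show ?thesis
      using node.IH[of j] by (intro exI[of _ j]) (simp add: node_input_def)
  qed
  then have "?x \<noteq> (\<lambda>_. 0)"
    by (metis less_irrefl)
  then have "f i ?x \<noteq> 0"
    using structural[OF node.hyps] composite_input_in_orthant[of i e] assms(2) node.hyps
    by (simp add: structural_function_def)
  then show ?case
    using composite_nonneg[of i e] node.hyps assms(2) by (simp add: composite_eq[of f i])
qed

lemma continuous_on_if_const:
  assumes "b \<Longrightarrow> continuous_on S g" "\<not> b \<Longrightarrow> continuous_on S h"
  shows "continuous_on S (\<lambda>x. if b then g x else h x)"
  using assms by (cases b) auto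

lemma continuous_on_composite:
  assumes "i \<in> V"
  shows "continuous_on {e. \<forall>j. 0 \<le> e j} (composite E f i)"
  using assms
proof (induction i rule: node_induct)
  case (node i)
  let ?x = "\<lambda>e. node_input E i (\<lambda>j. composite E f j e) (e i)"
  have x: "continuous_on {e. \<forall>j. 0 \<le> e j} ?x"
  proof (rule continuous_on_coordinatewise_then_product)
    fix k
    have "continuous_on {e::nat \<Rightarrow> real. \<forall>j. 0 \<le> e j} (\<lambda>e. e i)"
      by (rule continuous_on_subset[OF continuous_on_product_coordinates]) simp
    moreover have "continuous_on {e. \<forall>j. 0 \<le> e j} (\<lambda>e. composite E f k e)" if "k \<in> parents E i"
      using node.IH[OF that] .
    ultimately show "continuous_on {e. \<forall>j. 0 \<le> e j} (\<lambda>e. ?x e k)"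
      unfolding node_input_def by (intro continuous_on_if_const continuous_on_const) auto
  qed
  have "?x ` {e. \<forall>j. 0 \<le> e j} \<subseteq> orthant (insert i (parents E i))"
    using node.hyps by (intro image_subsetI composite_input_in_orthant) simp_all
  moreover have "continuous_on (orthant (insert i (parents E i))) (f i)"
    using structural[OF node.hyps] by (simp add: structural_function_def)
  ultimately have "continuous_on {e. \<forall>j. 0 \<le> e j} (\<lambda>e. f i (?x e))"
    using continuous_on_compose2[OF _ x] by blast
  moreover have "composite E f i = (\<lambda>e. f i (?x e))"
    by (rule ext) (rule composite_eq)
  ultimately show ?case
    by simp
qed

text \<open>The unit box is compact in the product topology even with infinitely many coordinates,
  so continuity bounds the composite by \<open>C\<close> there; homogeneity carries the bound to
  side \<open>x\<close>.\<close>

lemma composite_bounded_on_box: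
  assumes "i \<in> V"
  obtains C where "0 < C" "\<And>e x. 0 < x \<Longrightarrow> (\<And>j. 0 \<le> e j \<and> e j \<le> x) \<Longrightarrow> composite E f i e \<le> C * x"
proof -
  let ?B = "PiE UNIV (\<lambda>_::nat. {0..1::real})"
  have "compactin (product_topology (\<lambda>_. euclidean) UNIV) ?B"
    by (simp add: compactin_PiE)
  then have "compact ?B"
    by (simp add: euclidean_product_topology)
  moreover have "continuous_on ?B (composite E f i)"
    by (rule continuous_on_subset[OF continuous_on_composite[OF assms]]) auto
  ultimately have "bounded (composite E f i ` ?B)"
    by (intro compact_imp_bounded compact_continuous_image)
  then obtain C where C: "0 < C" "\<And>e. e \<in> ?B \<Longrightarrow> \<bar>composite E f i e\<bar> \<le> C"
    unfolding bounded_pos by auto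
  show ?thesis
  proof (rule that[OF C(1)])
    fix e :: "nat \<Rightarrow> real" and x :: real
    assume x: "0 < x" and e: "\<And>j. 0 \<le> e j \<and> e j \<le> x"
    have "composite E f i (\<lambda>j. x * (e j / x)) = x * composite E f i (\<lambda>j. e j / x)"
      using x e assms by (intro composite_scale) auto
    moreover have "\<bar>composite E f i (\<lambda>j. e j / x)\<bar> \<le> C"
      using x e by (intro C(2)) (auto simp: divide_simps)
    ultimately show "composite E f i e \<le> C * x"
      using x by (auto simp: mult.commute)
  qed
qed

text \<open>
  Clamping the input makes this function total, continuous and measurable on the whole function
  space, so that it can be applied to elements of a product measure space.
\<close>

definition response :: "nat \<Rightarrow> (nat \<Rightarrow> real) \<Rightarrow> real" where
  "response i e = composite E f i (\<lambda>j. if j \<in> V then max 0 (e j) else 0)"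

lemma response_eq_composite:
  assumes "i \<in> V" "\<And>j. j \<in> V \<Longrightarrow> 0 \<le> e j"
  shows "response i e = composite E f i e"
  unfolding response_def using assms Ancestors_subset by (intro composite_eqI) auto

lemma response_cong:
  assumes "i \<in> V" "\<And>j. j \<in> Ancestors E i \<Longrightarrow> e j = e' j"
  shows "response i e = response i e'"
  unfolding response_def using assms by (intro composite_eqI) auto

text \<open>The clamped composite is continuous on the whole function space, whose Borel sets are
  those of the countable product. Vectors indexed by \<open>V\<close> are padded with zeros before
  it is applied.\<close>

lemma response_measurable [measurable]:
  assumes "i \<in> V"
  shows "response i \<in> borel_measurable (\<Pi>\<^sub>M j\<in>V. borel)"
proof -
  have "continuous_on UNIV (\<lambda>e. composite E f i (\<lambda>j. max 0 (e j)))"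
    by (rule continuous_on_compose2[OF continuous_on_composite[OF assms]])
      (auto intro!: continuous_on_coordinatewise_then_product continuous_intros
        simp: continuous_on_product_coordinates)
  then have "(\<lambda>e. composite E f i (\<lambda>j. max 0 (e j))) \<in> borel_measurable (\<Pi>\<^sub>M j\<in>UNIV. borel)"
    using borel_measurable_continuous_onI measurable_cong_sets[OF sets_PiM_equal_borel refl] by blast
  moreover have "(\<lambda>e j. if j \<in> V then e j else 0) \<in> measurable (\<Pi>\<^sub>M j\<in>V. borel) (\<Pi>\<^sub>M j\<in>UNIV. borel :: real measure)"
  proof (rule measurable_PiM_single')
    fix j
    show "(\<lambda>e. if j \<in> V then e j else 0) \<in> borel_measurable (\<Pi>\<^sub>M j\<in>V. borel :: real measure)"
      by (cases "j \<in> V") auto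
  qed auto
  ultimately have "(\<lambda>e. composite E f i (\<lambda>j. max 0 (if j \<in> V then e j else 0))) \<in> borel_measurable (\<Pi>\<^sub>M j\<in>V. borel)"
    by (rule measurable_compose_rev)
  moreover have "response i = (\<lambda>e. composite E f i (\<lambda>j. max 0 (if j \<in> V then e j else 0)))"
    by (auto simp: response_def fun_eq_iff intro!: arg_cong[of _ _ "composite E f i"])
  ultimately show ?thesis
    by simp
qed

lemma response_bounded_on_box:
  assumes "i \<in> V"
  obtains C where "0 < C" "\<And>e x. 0 < x \<Longrightarrow> (\<And>j. j \<in> V \<Longrightarrow> e j \<le> x) \<Longrightarrow> response i e \<le> C * x"
proof -
  obtain C where C: "0 < C"
    "\<And>e x. 0 < x \<Longrightarrow> (\<And>j. 0 \<le> e j \<and> e j \<le> x) \<Longrightarrow> composite E f i e \<le> C * x"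
    using composite_bounded_on_box[OF assms] by blast
  show ?thesis
    by (rule that[OF C(1)]) (auto simp: response_def intro!: C(2))
qed

text \<open>By homogeneity the quotient is the composite at the vector with entry 1 at
  \<open>h\<close> and the other clamped entries of \<open>y\<close> divided by \<open>t\<close>.
  This vector tends to the unit vector at \<open>h\<close>, and continuity gives the AIR
  entry.\<close>

lemma response_asymptotic:
  assumes "i \<in> V" "h \<in> V"
  shows "((\<lambda>t. response i (y(h := t)) / t) \<longlongrightarrow> air_matrix E f h i) at_top"
proof -
  define p where "p = (\<lambda>j. if j \<in> V then max 0 (y j) else 0)"
  \<comment> \<open>\<open>s\<close> stands for \<open>1 / t\<close>, so the claim becomes
    continuity at \<open>s = 0\<close> from the right.\<close>
  define K where "K = (\<lambda>s. composite E f i (\<lambda>j. if j = h then 1 else s * p j))"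
  have p: "0 \<le> p j" for j
    by (simp add: p_def)
  have "continuous_on {0..} K"
    unfolding K_def
  proof (rule continuous_on_compose2[OF continuous_on_composite[OF assms(1)]])
    show "continuous_on {0..} (\<lambda>s j. if j = h then 1 else s * p j)"
    proof (rule continuous_on_coordinatewise_then_product)
      fix j
      show "continuous_on {0..} (\<lambda>s. if j = h then 1 else s * p j)"
        by (cases "j = h") (auto intro!: continuous_intros)
    qed
  qed (use p in auto)
  then have "(K \<longlongrightarrow> K 0) (at 0 within {0..})"
    by (simp add: continuous_on)
  moreover have "filterlim (\<lambda>t::real. 1 / t) (at 0 within {0..}) at_top"
    unfolding filterlim_at
  proof
    show "\<forall>\<^sub>F t in at_top. 1 / t \<in> {0..} \<and> 1 / t \<noteq> (0::real)"
      using eventually_gt_at_top[of 0] by eventually_elim auto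
    show "((\<lambda>t. 1 / t) \<longlongrightarrow> (0::real)) at_top"
      by (rule tendsto_divide_0[OF tendsto_const filterlim_at_top_imp_at_infinity[OF filterlim_ident]])
  qed
  ultimately have "((\<lambda>t. K (1 / t)) \<longlongrightarrow> K 0) at_top"
    by (rule filterlim_compose)
  moreover have "\<forall>\<^sub>F t in at_top. K (1 / t) = response i (y(h := t)) / t"
    using eventually_gt_at_top[of 0]
  proof eventually_elim
    case (elim t)
    have "(\<lambda>j. if j \<in> V then max 0 ((y(h := t)) j) else 0) =
        (\<lambda>j. t * (if j = h then 1 else 1 / t * p j))"
      using elim assms(2) by (auto simp: p_def fun_eq_iff)
    then have "response i (y(h := t)) = t * K (1 / t)"
      using elim assms(1) p unfolding response_def K_def
      by (simp only:) (rule composite_scale, auto)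
    then show ?case
      using elim by simp
  qed
  ultimately have "((\<lambda>t. response i (y(h := t)) / t) \<longlongrightarrow> K 0) at_top"
    by (rule Lim_transform_eventually)
  moreover have "K 0 = air_matrix E f h i"
  proof (cases "h \<in> Ancestors E i")
    case True
    then show ?thesis
      by (auto simp: K_def air_matrix_def unit_vec_def intro!: arg_cong[of _ _ "composite E f i"])
  next
    case False
    have "K 0 = composite E f i (\<lambda>_. 0)"
      unfolding K_def using False by (intro composite_eqI) auto
    then show ?thesis
      using False assms by (simp add: air_matrix_def composite_zero)
  qed
  ultimately show ?thesis by simp
qed

lemma air_matrix_pos:
  assumes "i \<in> V" "h \<in> Ancestors E i"
  shows "0 < air_matrix E f h i"
  using composite_pos[of i "unit_vec h" h] assms by (simp add: air_matrix_def unit_vec_def)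

lemma air_matrix_nonneg: "i \<in> V \<Longrightarrow> 0 \<le> air_matrix E f h i"
  using air_matrix_pos[of i h] by (cases "h \<in> Ancestors E i") (auto simp: air_matrix_def)

lemma air_matrix_powr_sum_pos:
  assumes "i \<in> V"
  shows "0 < (\<Sum>h\<in>Ancestors E i. air_matrix E f h i powr a)"
proof (rule sum_pos)
  show "finite (Ancestors E i)"
    using Ancestors_subset[OF assms] finite_V by (rule finite_subset)
  show "Ancestors E i \<noteq> {}"
    by (simp add: Ancestors_def)
  show "0 < air_matrix E f h i powr a" if "h \<in> Ancestors E i" for h
    using air_matrix_pos[OF assms that] by simp
qed

lemma std_air_matrix_powr:
  assumes "i \<in> V" "\<alpha> > 0"
  shows "std_air_matrix E f \<alpha> h i powr \<alpha> =
    air_matrix E f h i powr \<alpha> / (\<Sum>k\<in>Ancestors E i. air_matrix E f k i powr \<alpha>)"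
  using assms air_matrix_nonneg
  by (simp add: std_air_matrix_def powr_divide powr_powr sum_nonneg)

end

section \<open>Regularly varying laws and the single big jump\<close>

text \<open>Regular variation enters only through the ratio limit, from which the slowly varying
  factor has cancelled. Positivity at every \<open>x\<close> makes all quotients by the tail
  meaningful.\<close>

locale regularly_varying_law = real_distribution \<mu> for \<mu> +
  fixes \<alpha> :: real
  assumes \<alpha>_pos: "0 < \<alpha>"
    and tail_pos: "\<And>x. 0 < measure \<mu> {x<..}"
    and tail_ratio: "\<And>c. 0 < c \<Longrightarrow>
      ((\<lambda>x. measure \<mu> {c * x<..} / measure \<mu> {x<..}) \<longlongrightarrow> c powr (-\<alpha>)) at_top"
begin

section \<open>One-dimensional tail asymptotics\<close>

definition tail :: "real \<Rightarrow> real" where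
  "tail x = measure \<mu> {x<..}"

lemma tail_nonneg: "0 \<le> tail x" and tail_greater_0: "0 < tail x"
  using tail_pos[of x] by (auto simp: tail_def)

lemma tail_tendsto_0: "(tail \<longlongrightarrow> 0) at_top"
proof -
  have "tail x = 1 - cdf \<mu> x" for x
  proof -
    have "{x<..} = space \<mu> - {..x}" by auto
    then show ?thesis
      using prob_compl[of "{..x}"] by (simp add: tail_def cdf_def)
  qed
  then have "tail = (\<lambda>x. 1 - cdf \<mu> x)" ..
  then show ?thesis
    using tendsto_diff[OF tendsto_const[of 1] cdf_lim_at_top_prob] by simp
qed

lemma tail_ratio_divide:
  assumes "0 < c"
  shows "((\<lambda>x. tail (x / c) / tail x) \<longlongrightarrow> c powr \<alpha>) at_top"
  using tail_ratio[of "1 / c"] assms by (simp add: tail_def powr_minus_divide powr_divide)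

text \<open>Since \<open>F t\<close> grows like \<open>a * t\<close>, the event
  \<open>x < F t\<close> is compared with \<open>x / c < t\<close> for slopes \<open>c\<close> just
  above and just below \<open>a\<close>. The assumption \<open>bound\<close> prevents large values
  of \<open>F\<close> at moderate \<open>t\<close>.\<close>

lemma tail_comp_asymptotic:
  assumes F [measurable]: "F \<in> borel_measurable borel"
    and slope: "((\<lambda>t. F t / t) \<longlongrightarrow> a) at_top" and a: "0 \<le> a" and C: "0 < C"
    and bound: "\<And>x t. K \<le> x \<Longrightarrow> t \<le> x \<Longrightarrow> F t \<le> C * x"
  shows "((\<lambda>x. measure \<mu> {t. x < F t} / tail x) \<longlongrightarrow> a powr \<alpha>) at_top"
proof (rule order_tendstoI)
  fix y assume y: "a powr \<alpha> < y"
  then have y0: "0 < y" using powr_ge_zero[of a \<alpha>] by linarith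
  \<comment> \<open>A slope \<open>c\<close> strictly between \<open>a\<close> and
    \<open>y powr (1 / \<alpha>)\<close> keeps the limit \<open>c powr \<alpha>\<close> of
    \<open>tail (x / c) / tail x\<close> below \<open>y\<close>.\<close>
  have "a = (a powr \<alpha>) powr (1 / \<alpha>)"
    using a \<alpha>_pos by (simp add: powr_powr)
  also have "\<dots> < y powr (1 / \<alpha>)"
    using y \<alpha>_pos by (intro powr_less_mono2) auto
  finally obtain c where c: "a < c" "c < y powr (1 / \<alpha>)"
    using dense by blast
  have "c powr \<alpha> < (y powr (1 / \<alpha>)) powr \<alpha>"
    using c a \<alpha>_pos by (intro powr_less_mono2) auto
  then have cy: "c powr \<alpha> < y"
    using y0 \<alpha>_pos by (simp add: powr_powr)
  obtain T where T: "\<And>t. T \<le> t \<Longrightarrow> F t / t < c"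
    using order_tendstoD(2)[OF slope c(1)] by (auto simp: eventually_at_top_linorder)
  have c0: "0 < c" using a c by simp
  have "\<forall>\<^sub>F x in at_top. tail (x / c) / tail x < y"
    using order_tendstoD(2)[OF tail_ratio_divide[OF c0] cy] .
  then show "\<forall>\<^sub>F x in at_top. measure \<mu> {t. x < F t} / tail x < y"
    using eventually_ge_at_top[of "C * Max {K, T, 1}"]
  proof eventually_elim
    case (elim x)
    have "{t. x < F t} \<subseteq> {x / c<..}"
    proof
      fix t assume "t \<in> {t. x < F t}"
      \<comment> \<open>Otherwise \<open>bound\<close> would give
        \<open>F t \<le> C * Max {K, T, 1} \<le> x\<close>. The entry 1 ensures
        \<open>0 < t\<close>.\<close>
      then have "Max {K, T, 1} < t"
        using elim(2) bound[of "Max {K, T, 1}" t] by (intro not_le_imp_less notI) simp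
      then have "F t / t < c" "0 < t"
        using T[of t] by auto
      then show "t \<in> {x / c<..}"
        using \<open>t \<in> {t. x < F t}\<close> c0 by (simp add: divide_simps mult.commute split: if_splits)
    qed
    then have "measure \<mu> {t. x < F t} \<le> tail (x / c)"
      unfolding tail_def by (intro finite_measure_mono) auto
    then have "measure \<mu> {t. x < F t} / tail x \<le> tail (x / c) / tail x"
      by (intro divide_right_mono tail_nonneg)
    then show ?case using elim(1) by simp
  qed
next
  fix y assume y: "y < a powr \<alpha>"
  show "\<forall>\<^sub>F x in at_top. y < measure \<mu> {t. x < F t} / tail x"
  \<comment> \<open>The root of \<open>y\<close> is useful only for nonnegative \<open>y\<close>;
    when \<open>a = 0\<close>, the negative case is the only one.\<close>
  proof (cases "y < 0")
    case True
    then show ?thesis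
      using tail_nonneg by (intro always_eventually allI) (meson divide_nonneg_nonneg less_le_trans measure_nonneg)
  next
    case False
    have "y powr (1 / \<alpha>) < (a powr \<alpha>) powr (1 / \<alpha>)"
      using y False \<alpha>_pos by (intro powr_less_mono2) auto
    also have "\<dots> = a"
      using a \<alpha>_pos by (simp add: powr_powr)
    finally obtain c where c: "y powr (1 / \<alpha>) < c" "c < a"
      using dense by blast
    have c0: "0 < c" using c(1) powr_ge_zero[of y "1 / \<alpha>"] by linarith
    have "(y powr (1 / \<alpha>)) powr \<alpha> < c powr \<alpha>"
      using c \<alpha>_pos by (intro powr_less_mono2) auto
    then have cy: "y < c powr \<alpha>"
      using False \<alpha>_pos by (simp add: powr_powr)
    obtain T where T: "\<And>t. T \<le> t \<Longrightarrow> c < F t / t"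
      using order_tendstoD(1)[OF slope c(2)] by (auto simp: eventually_at_top_linorder)
    have "\<forall>\<^sub>F x in at_top. y < tail (x / c) / tail x"
      using order_tendstoD(1)[OF tail_ratio_divide[OF c0] cy] .
    then show ?thesis
      using eventually_ge_at_top[of "c * max T 1"]
    proof eventually_elim
      case (elim x)
      have "{x / c<..} \<subseteq> {t. x < F t}"
      proof
        fix t assume t: "t \<in> {x / c<..}"
        have "max T 1 \<le> x / c"
          using elim(2) c0 pos_le_divide_eq[of c "max T 1" x] by (simp only: mult.commute)
        then have "max T 1 < t"
          using t by auto
        then have "c < F t / t" "0 < t"
          using T[of t] by auto
        moreover have "x < c * t"
          using t c0 by (simp add: field_simps)
        ultimately show "t \<in> {t. x < F t}"
          by (simp add: field_simps)
      qed
      then have "tail (x / c) \<le> measure \<mu> {t. x < F t}"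
        unfolding tail_def by (intro finite_measure_mono) auto
      then have "tail (x / c) / tail x \<le> measure \<mu> {t. x < F t} / tail x"
        by (intro divide_right_mono tail_nonneg)
      then show ?case using elim(1) by simp
    qed
  qed
qed

text \<open>For large \<open>x\<close> every \<open>t\<close> with \<open>x < F t\<close> is itself
  large, so \<open>g\<close> is uniformly close to \<open>l\<close> on the event and can be replaced
  by it at a cost proportional to the event's probability.\<close>

lemma tail_integral_asymptotic:
  assumes F [measurable]: "F \<in> borel_measurable borel"
    and slope: "((\<lambda>t. F t / t) \<longlongrightarrow> a) at_top" and a: "0 \<le> a" and C: "0 < C"
    and bound: "\<And>x t. K \<le> x \<Longrightarrow> t \<le> x \<Longrightarrow> F t \<le> C * x"
    and g [measurable]: "g \<in> borel_measurable borel" and g_le: "\<And>t. \<bar>g t\<bar> \<le> B"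
    and g_lim: "(g \<longlongrightarrow> l) at_top"
  shows "((\<lambda>x. (\<integral>t. g t * indicator {t. x < F t} t \<partial>\<mu>) / tail x) \<longlongrightarrow> a powr \<alpha> * l) at_top"
proof -
  define r where "r x = measure \<mu> {t. x < F t} / tail x" for x
  have r: "(r \<longlongrightarrow> a powr \<alpha>) at_top"
    unfolding r_def by (rule tail_comp_asymptotic[OF F slope a C bound])
  have r_nonneg: "0 \<le> r x" for x
    by (simp add: r_def tail_nonneg)
  have int: "integrable \<mu> (\<lambda>t. g t * indicator {t. x < F t} t)" for x
    using g_le by (intro integrable_const_bound[where B = B]) (auto simp: indicator_def intro: order_trans[OF abs_ge_zero])
  have "((\<lambda>x. (\<integral>t. g t * indicator {t. x < F t} t \<partial>\<mu>) / tail x - r x * l) \<longlongrightarrow> 0) at_top"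
  proof (rule tendstoI)
    fix e :: real assume e: "0 < e"
    \<comment> \<open>The ratio \<open>r x\<close> is eventually below
      \<open>a powr \<alpha> + 1\<close>, so this choice keeps the total error below
      \<open>e\<close>.\<close>
    define e' where "e' = e / (a powr \<alpha> + 1)"
    have e': "0 < e'" using e powr_ge_zero[of a \<alpha>] by (simp add: e'_def add_nonneg_pos)
    obtain T where T: "\<And>t. T \<le> t \<Longrightarrow> \<bar>g t - l\<bar> < e'"
      using tendstoD[OF g_lim e'] by (auto simp: eventually_at_top_linorder dist_real_def)
    have "\<forall>\<^sub>F x in at_top. r x < a powr \<alpha> + 1"
      by (rule order_tendstoD(2)[OF r]) simp
    then show "\<forall>\<^sub>F x in at_top.
        dist ((\<integral>t. g t * indicator {t. x < F t} t \<partial>\<mu>) / tail x - r x * l) 0 < e"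
      using eventually_ge_at_top[of "C * max K T"]
    proof eventually_elim
      case (elim x)
      have *: "\<bar>(g t - l) * indicator {t. x < F t} t\<bar> \<le> e' * indicator {t. x < F t} t" for t
      proof (cases "x < F t")
        case True
        then have "max K T < t"
          using elim(2) bound[of "max K T" t] by (intro not_le_imp_less notI) simp
        then show ?thesis
          using T[of t] by (auto simp: indicator_def)
      qed simp
      have int_l: "integrable \<mu> (\<lambda>t. l * indicator {t. x < F t} t)"
        by (intro integrable_mult_right integrable_real_indicator) (auto simp: emeasure_eq_measure)
      have "(\<integral>t. g t * indicator {t. x < F t} t \<partial>\<mu>) - measure \<mu> {t. x < F t} * l
          = (\<integral>t. (g t - l) * indicator {t. x < F t} t \<partial>\<mu>)"
        using int[of x] int_l by (simp add: left_diff_distrib)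
      also have "\<bar>\<dots>\<bar> \<le> (\<integral>t. e' * indicator {t. x < F t} t \<partial>\<mu>)"
      proof (rule integral_abs_bound_integral[OF _ _ *])
        show "integrable \<mu> (\<lambda>t. (g t - l) * indicator {t. x < F t} t)"
          using Bochner_Integration.integrable_diff[OF int[of x] int_l] by (simp add: left_diff_distrib)
        show "integrable \<mu> (\<lambda>t. e' * indicator {t. x < F t} t)"
          by (intro integrable_mult_right integrable_real_indicator) (auto simp: emeasure_eq_measure)
      qed
      also have "\<dots> = e' * measure \<mu> {t. x < F t}"
        by simp
      finally have "\<bar>(\<integral>t. g t * indicator {t. x < F t} t \<partial>\<mu>) - measure \<mu> {t. x < F t} * l\<bar> / tail x
          \<le> e' * r x"
        using tail_greater_0[of x] by (simp add: r_def divide_right_mono)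
      also have "\<dots> < e' * (a powr \<alpha> + 1)"
        using elim(1) e' by simp
      also have "\<dots> = e"
        using powr_ge_zero[of a \<alpha>] by (auto simp: e'_def add_nonneg_eq_0_iff)
      finally show ?case
        using tail_greater_0[of x] by (simp add: r_def diff_divide_distrib[symmetric])
    qed
  qed
  then show ?thesis
    using tendsto_add[OF _ tendsto_mult_right[OF r, of l]] by fastforce
qed

section \<open>Independent copies and the single big jump\<close>

abbreviation law :: "'i set \<Rightarrow> ('i \<Rightarrow> real) measure" where
  "law V \<equiv> (\<Pi>\<^sub>M i\<in>V. \<mu>)"

lemma measurable_law: "measurable (law V) N = measurable (\<Pi>\<^sub>M i\<in>V. borel) N"
  by (intro measurable_cong_sets sets_PiM_cong) auto

lemma prob_space_law: "prob_space (law V)"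
  by (rule prob_space_PiM) unfold_locales

lemma integral_law_const: "(\<integral>e. (c :: real) \<partial>law V) = c"
proof -
  interpret N: prob_space "law V" by (rule prob_space_law)
  show ?thesis by (simp add: N.prob_space)
qed

text \<open>Fubini's theorem with coordinate \<open>h\<close> integrated first; the bound
  \<open>B\<close> provides integrability.\<close>

lemma integral_law_update:
  fixes g :: "('i \<Rightarrow> real) \<Rightarrow> real"
  assumes "finite V" "h \<in> V" "g \<in> borel_measurable (\<Pi>\<^sub>M i\<in>V. borel)" "\<And>e. \<bar>g e\<bar> \<le> B"
  shows "(\<integral>e. g e \<partial>law V) = (\<integral>y. (\<integral>t. g (y(h := t)) \<partial>\<mu>) \<partial>law (V - {h}))"
proof -
  interpret N: prob_space "law V" by (rule prob_space_law)
  interpret prod: product_sigma_finite "\<lambda>_. \<mu>" by unfold_locales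
  have "integrable (law V) g"
    using assms by (intro N.integrable_const_bound[where B = B]) (auto simp: measurable_law)
  then show ?thesis
    using prod.product_integral_insert[of "V - {h}" h g] assms(1,2) by (simp add: insert_absorb)
qed

lemma measurable_update:
  assumes "h \<in> V"
  shows "(\<lambda>(y, t). y(h := t)) \<in> measurable (law (V - {h}) \<Otimes>\<^sub>M \<mu>) (\<Pi>\<^sub>M i\<in>V. borel)"
proof -
  have "(\<lambda>z. (fst z)(h := snd z)) \<in> measurable (law (V - {h}) \<Otimes>\<^sub>M \<mu>) (\<Pi>\<^sub>M i\<in>V. borel)"
  proof (rule measurable_fun_upd)
    show "V = (V - {h}) \<union> {h}" using assms by auto
    have "fst \<in> measurable (law (V - {h}) \<Otimes>\<^sub>M \<mu>) (law (V - {h}))" by (rule measurable_fst)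
    then show "fst \<in> measurable (law (V - {h}) \<Otimes>\<^sub>M \<mu>) (\<Pi>\<^sub>M i\<in>V - {h}. borel)"
      by (subst measurable_cong_sets[OF refl sets_PiM_cong[OF refl]]) auto
  qed auto
  then show ?thesis by (simp add: case_prod_unfold)
qed

text \<open>
  If all coordinates except \<open>h\<close> are at most \<open>x / C\<close>, then \<open>x < \<Phi> e\<close> forces \<open>x / C < e h\<close>. This bounds
  the inner integral over coordinate \<open>h\<close> by a multiple of \<open>tail x\<close> and makes dominated convergence
  in the other coordinates applicable.
\<close>

lemma single_big_jump_coordinate:
  fixes \<Phi> \<psi> :: "('i \<Rightarrow> real) \<Rightarrow> real"
  assumes V: "finite V" "h \<in> V"
    and \<Phi> [measurable]: "\<Phi> \<in> borel_measurable (\<Pi>\<^sub>M i\<in>V. borel)"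
    and bound: "\<And>e x. 0 < x \<Longrightarrow> (\<And>j. j \<in> V \<Longrightarrow> e j \<le> x) \<Longrightarrow> \<Phi> e \<le> C * x" and C: "0 < C"
    and slope: "\<And>y. ((\<lambda>t. \<Phi> (y(h := t)) / t) \<longlongrightarrow> a) at_top" and a: "0 \<le> a"
    and \<psi> [measurable]: "\<psi> \<in> borel_measurable (\<Pi>\<^sub>M i\<in>V. borel)"
    and \<psi>_le: "\<And>e. \<bar>\<psi> e\<bar> \<le> B"
    and \<psi>_lim: "\<And>y. ((\<lambda>t. \<psi> (y(h := t))) \<longlongrightarrow> \<psi>' y) at_top"
  shows "((\<lambda>x. (\<integral>e. \<psi> e * indicator {e. x < \<Phi> e \<and> (\<forall>k\<in>V - {h}. e k \<le> x / C)} e \<partial>law V) / tail x)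
    \<longlongrightarrow> a powr \<alpha> * (\<integral>y. \<psi>' y \<partial>law (V - {h}))) at_top"
proof -
  have upd: "(\<lambda>t. y(h := t)) \<in> measurable borel (\<Pi>\<^sub>M i\<in>V. borel)" if "y \<in> space (law (V - {h}))" for y
    using measurable_compose[OF measurable_Pair1'[OF that] measurable_update[OF V(2)]]
    by (simp cong: measurable_cong_sets)
  have upd': "(\<lambda>y. y(h := t)) \<in> measurable (law (V - {h})) (\<Pi>\<^sub>M i\<in>V. borel)" for t
    using measurable_compose[OF measurable_Pair2' measurable_update[OF V(2)], of t] by simp
  have B: "0 \<le> B"
    using \<psi>_le[of undefined] by linarith
  define G where "G x e = \<psi> e * indicator {e. x < \<Phi> e \<and> (\<forall>k\<in>V - {h}. e k \<le> x / C)} e" for x e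
  have G_meas [measurable]: "G x \<in> borel_measurable (\<Pi>\<^sub>M i\<in>V. borel)" for x
  proof -
    have [measurable]: "(\<lambda>e. e k) \<in> borel_measurable (\<Pi>\<^sub>M i\<in>V. borel :: real measure)" if "k \<in> V - {h}" for k
      using that by simp
    have "Measurable.pred (\<Pi>\<^sub>M i\<in>V. borel) (\<lambda>e. x < \<Phi> e \<and> (\<forall>k\<in>V - {h}. e k \<le> x / C))"
      using V(1) by (intro pred_intros_logic pred_intros_finite) measurable
    then show ?thesis
      unfolding G_def indicator_def by measurable
  qed
  have G_le: "\<bar>G x e\<bar> \<le> B" for x e
    using \<psi>_le[of e] B by (auto simp: G_def indicator_def)
  define J where "J x y = (\<integral>t. G x (y(h := t)) \<partial>\<mu>)" for x y
  have J_meas: "J x \<in> borel_measurable (law (V - {h}))" for x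
    unfolding J_def
    by (rule borel_measurable_lebesgue_integral)
      (use measurable_compose[OF measurable_update[OF V(2)] G_meas] in \<open>simp add: case_prod_unfold\<close>)
  have J_le: "\<bar>J x y\<bar> \<le> B * tail (x / C)" if y: "y \<in> space (law (V - {h}))" and x: "0 < x" for x y
  proof -
    have "\<bar>G x (y(h := t))\<bar> \<le> B * indicator {x / C<..} t" for t
    proof (cases "x < \<Phi> (y(h := t)) \<and> (\<forall>k\<in>V - {h}. (y(h := t)) k \<le> x / C)")
      case True
      have "x / C < t"
      proof (rule ccontr)
        assume "\<not> x / C < t"
        then have "\<Phi> (y(h := t)) \<le> C * (x / C)"
          using True x C by (intro bound) auto
        then show False using True C by simp
      qed
      then show ?thesis
        using G_le by simp
    next
      case False
      then show ?thesis
        using B by (simp add: G_def)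
    qed
    then have "\<bar>J x y\<bar> \<le> (\<integral>t. B * indicator {x / C<..} t \<partial>\<mu>)"
      unfolding J_def
    proof (rule integral_abs_bound_integral[rotated 2])
      show "integrable \<mu> (\<lambda>t. G x (y(h := t)))"
        using measurable_compose[OF upd[OF y] G_meas] G_le by (intro integrable_const_bound[where B = B]) auto
      show "integrable \<mu> (\<lambda>t. B * indicator {x / C<..} t)"
        by (intro integrable_mult_right integrable_real_indicator) (auto simp: emeasure_eq_measure)
    qed
    then show ?thesis
      by (simp add: tail_def)
  qed
  \<comment> \<open>\<open>\<psi>'\<close> is known only as a limit, so its measurability is
    obtained along integer jump sizes.\<close>
  have "(\<lambda>n. \<psi> (y(h := real n))) \<longlonglongrightarrow> \<psi>' y" for y
    by (rule filterlim_compose[OF \<psi>_lim filterlim_real_sequentially])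
  then have \<psi>'_meas: "\<psi>' \<in> borel_measurable (law (V - {h}))"
    by (rule borel_measurable_LIMSEQ_real) (rule measurable_compose[OF upd' \<psi>])
  have "((\<lambda>x. \<integral>y. J x y / tail x \<partial>law (V - {h})) \<longlongrightarrow> (\<integral>y. a powr \<alpha> * \<psi>' y \<partial>law (V - {h}))) at_top"
  proof (rule integral_dominated_convergence_at_top)
    show "(\<lambda>y. a powr \<alpha> * \<psi>' y) \<in> borel_measurable (law (V - {h}))"
      using \<psi>'_meas by simp
    show "(\<lambda>y. J x y / tail x) \<in> borel_measurable (law (V - {h}))" for x
      using J_meas by simp
    interpret N: prob_space "law (V - {h})" by (rule prob_space_law)
    show "integrable (law (V - {h})) (\<lambda>_. B * (C powr \<alpha> + 1))"
      by simp
    \<comment> \<open>Together with \<open>J_le\<close> this yields a constant majorant for all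
      large \<open>x\<close>.\<close>
    have "\<forall>\<^sub>F x in at_top. tail (x / C) / tail x < C powr \<alpha> + 1"
      by (rule order_tendstoD(2)[OF tail_ratio_divide[OF C]]) simp
    then show "\<forall>\<^sub>F x in at_top. AE y in law (V - {h}). norm (J x y / tail x) \<le> B * (C powr \<alpha> + 1)"
      using eventually_gt_at_top[of 0]
    proof eventually_elim
      case (elim x)
      have "norm (J x y / tail x) \<le> B * (C powr \<alpha> + 1)" if "y \<in> space (law (V - {h}))" for y
      proof -
        have "norm (J x y / tail x) \<le> B * tail (x / C) / tail x"
          using J_le[OF that elim(2)] tail_greater_0[of x] by (simp add: divide_right_mono)
        also have "\<dots> \<le> B * (C powr \<alpha> + 1)"
          using mult_left_mono[OF less_imp_le[OF elim(1)] B] by simp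
        finally show ?thesis .
      qed
      then show ?case by (rule AE_I2)
    qed
    have "((\<lambda>x. J x y / tail x) \<longlongrightarrow> a powr \<alpha> * \<psi>' y) at_top" if y: "y \<in> space (law (V - {h}))" for y
    proof -
      define K where "K = Max (insert 1 (y ` V))"
      have K: "1 \<le> K" "\<And>k. k \<in> V \<Longrightarrow> y k \<le> K"
        using V(1) by (auto simp: K_def)
      have "((\<lambda>x. (\<integral>t. \<psi> (y(h := t)) * indicator {t. x < \<Phi> (y(h := t))} t \<partial>\<mu>) / tail x)
          \<longlongrightarrow> a powr \<alpha> * \<psi>' y) at_top"
      proof (rule tail_integral_asymptotic[OF _ slope a C])
        show "(\<lambda>t. \<Phi> (y(h := t))) \<in> borel_measurable borel" "(\<lambda>t. \<psi> (y(h := t))) \<in> borel_measurable borel"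
          by (rule measurable_compose[OF upd[OF y]], fact)+
        show "\<Phi> (y(h := t)) \<le> C * x" if "K \<le> x" "t \<le> x" for x t
          using that K by (intro bound) (auto intro: order_trans)
      qed (rule \<psi>_le \<psi>_lim)+
      moreover have "\<forall>\<^sub>F x in at_top.
          (\<integral>t. \<psi> (y(h := t)) * indicator {t. x < \<Phi> (y(h := t))} t \<partial>\<mu>) / tail x = J x y / tail x"
        using eventually_ge_at_top[of "C * K"]
      proof eventually_elim
        case (elim x)
        then have "K \<le> x / C"
          using C by (simp add: pos_le_divide_eq mult.commute)
        then have "\<forall>k\<in>V - {h}. y k \<le> x / C"
          using K(2) order_trans by blast
        then show ?case
          by (auto simp: J_def G_def indicator_def intro!: arg_cong2[of _ _ _ _ "(/)"] Bochner_Integration.integral_cong)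
      qed
      ultimately show ?thesis
        by (rule Lim_transform_eventually)
    qed
    then show "AE y in law (V - {h}). ((\<lambda>x. J x y / tail x) \<longlongrightarrow> a powr \<alpha> * \<psi>' y) at_top"
      by (rule AE_I2)
  qed
  moreover have "(\<integral>y. J x y / tail x \<partial>law (V - {h})) = (\<integral>e. G x e \<partial>law V) / tail x" for x
    using integral_law_update[OF V G_meas G_le] by (simp add: J_def)
  ultimately have "((\<lambda>x. (\<integral>e. G x e \<partial>law V) / tail x)
      \<longlongrightarrow> a powr \<alpha> * (\<integral>y. \<psi>' y \<partial>law (V - {h}))) at_top"
    by (simp only: integral_mult_right_zero)
  then show ?thesis
    unfolding G_def .
qed

text \<open>The event is a box with two constrained sides, so independence applies. The square is
  what makes two simultaneous jumps negligible against one.\<close>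

lemma law_both_exceed:
  assumes "finite V" "h \<in> V" "k \<in> V" "h \<noteq> k"
  shows "measure (law V) {e \<in> space (law V). u < e h \<and> u < e k} = tail u ^ 2"
proof -
  interpret N: finite_product_prob_space "\<lambda>_. \<mu>" V
    by unfold_locales fact
  have "{e \<in> space (law V). u < e h \<and> u < e k} = PiE V (\<lambda>j. if j \<in> {h, k} then {u<..} else UNIV)"
    using assms(2,3) by (auto simp: space_PiM PiE_iff extensional_def split: if_splits)
  also have "measure (law V) \<dots> = (\<Prod>j\<in>V. if j \<in> {h, k} then tail u else 1)"
    by (subst N.prob_times) (auto simp: tail_def prob_space[simplified] intro!: prod.cong)
  also have "\<dots> = (\<Prod>j\<in>{h, k}. tail u)"
    using assms by (subst prod.inter_restrict[symmetric]) (auto simp: Int_absorb1)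
  finally show ?thesis
    using assms(4) by (simp add: power2_eq_square)
qed

text \<open>Used twice: with the constant 1 for the probability of the conditioning event, and with
  a centred cdf transform for the numerator of the conditional mean. Each summand is the
  contribution of coordinate \<open>h\<close> alone being large.\<close>

lemma single_big_jump:
  fixes \<Phi> \<psi> :: "('i \<Rightarrow> real) \<Rightarrow> real"
  assumes V: "finite V"
    and \<Phi> [measurable]: "\<Phi> \<in> borel_measurable (\<Pi>\<^sub>M i\<in>V. borel)"
    and bound: "\<And>e x. 0 < x \<Longrightarrow> (\<And>j. j \<in> V \<Longrightarrow> e j \<le> x) \<Longrightarrow> \<Phi> e \<le> C * x" and C: "0 < C"
    and slope: "\<And>h y. h \<in> V \<Longrightarrow> ((\<lambda>t. \<Phi> (y(h := t)) / t) \<longlongrightarrow> a h) at_top"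
    and a: "\<And>h. h \<in> V \<Longrightarrow> 0 \<le> a h"
    and \<psi> [measurable]: "\<psi> \<in> borel_measurable (\<Pi>\<^sub>M i\<in>V. borel)"
    and \<psi>_le: "\<And>e. \<bar>\<psi> e\<bar> \<le> B"
    and \<psi>_lim: "\<And>h y. h \<in> V \<Longrightarrow> ((\<lambda>t. \<psi> (y(h := t))) \<longlongrightarrow> \<psi>' h y) at_top"
  shows "((\<lambda>x. (\<integral>e. \<psi> e * indicator {e. x < \<Phi> e} e \<partial>law V) / tail x)
    \<longlongrightarrow> (\<Sum>h\<in>V. a h powr \<alpha> * (\<integral>y. \<psi>' h y \<partial>law (V - {h})))) at_top"
proof -
  interpret N: prob_space "law V" by (rule prob_space_law)
  have B: "0 \<le> B"
    using \<psi>_le[of undefined] by linarith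
  define S where "S h x = {e. x < \<Phi> e \<and> (\<forall>k\<in>V - {h}. e k \<le> x / C)}" for h x
  define P where "P h k x = {e \<in> space (law V). x / C < e h \<and> x / C < e k}" for h k x
  have coord [measurable]: "(\<lambda>e. e k) \<in> borel_measurable (\<Pi>\<^sub>M i\<in>V. borel :: real measure)" if "k \<in> V" for k
    using that by simp
  have int_\<Phi>: "integrable (law V) (\<lambda>e. \<psi> e * indicator {e. x < \<Phi> e} e)" for x
  proof (rule N.integrable_const_bound[where B = B])
    show "(\<lambda>e. \<psi> e * indicator {e. x < \<Phi> e} e) \<in> borel_measurable (law V)"
      unfolding measurable_law indicator_def by measurable
  qed (use \<psi>_le B in \<open>auto simp: indicator_def\<close>)
  have int_S: "integrable (law V) (\<lambda>e. \<psi> e * indicator (S h x) e)" for h x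
  proof (rule N.integrable_const_bound[where B = B])
    have [measurable]: "(\<lambda>e. e k) \<in> borel_measurable (\<Pi>\<^sub>M i\<in>V. borel :: real measure)" if "k \<in> V - {h}" for k
      using that by simp
    have "Measurable.pred (\<Pi>\<^sub>M i\<in>V. borel) (\<lambda>e. x < \<Phi> e \<and> (\<forall>k\<in>V - {h}. e k \<le> x / C))"
      using V by (intro pred_intros_logic pred_intros_finite) measurable
    then show "(\<lambda>e. \<psi> e * indicator (S h x) e) \<in> borel_measurable (law V)"
      unfolding measurable_law indicator_def S_def by measurable
  qed (use \<psi>_le B in \<open>auto simp: indicator_def\<close>)
  have int_P: "integrable (law V) (indicator (P h k x) :: _ \<Rightarrow> real)" if "h \<in> V" "k \<in> V" for h k x
  proof -
    have "P h k x \<in> sets (law V)"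
      unfolding P_def using that by measurable
    then show ?thesis
      by (intro integrable_real_indicator) (auto simp: N.emeasure_eq_measure)
  qed
  \<comment> \<open>The sets \<open>S h x\<close> are disjoint and exhaust \<open>{e. x < \<Phi> e}\<close> up to vectors with two coordinates
    above \<open>x / C\<close>, an event of probability \<open>O(tail (x / C) ^ 2)\<close>.\<close>
  define R where "R x e = \<psi> e * indicator {e. x < \<Phi> e} e - (\<Sum>h\<in>V. \<psi> e * indicator (S h x) e)" for x e
  define Q where "Q x e = B * (\<Sum>h\<in>V. \<Sum>k\<in>V - {h}. indicator (P h k x) e)" for x e
  have R_le: "\<bar>R x e\<bar> \<le> Q x e" if x: "0 < x" and e: "e \<in> space (law V)" for x e
  proof (cases "x < \<Phi> e")
    case False
    then show ?thesis
      using B by (auto simp: R_def Q_def S_def intro!: mult_nonneg_nonneg sum_nonneg)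
  next
    case True
    obtain h where h: "h \<in> V" "x / C < e h"
    proof (rule ccontr)
      assume "\<not> thesis"
      then have "\<And>j. j \<in> V \<Longrightarrow> e j \<le> x / C"
        using that by force
      then have "\<Phi> e \<le> C * (x / C)"
        using x C by (intro bound) auto
      then show False
        using True C by simp
    qed
    show ?thesis
    proof (cases "\<exists>k\<in>V - {h}. x / C < e k")
      case False
      \<comment> \<open>With \<open>h\<close> the only large coordinate, \<open>e\<close> lies in
        exactly one of the sets and the remainder vanishes.\<close>
      have "e \<in> S l x \<longleftrightarrow> l = h" if "l \<in> V" for l
        using False h that True by (cases "l = h") (auto simp: S_def not_less dest!: bspec[where x = h])
      then have "(\<Sum>l\<in>V. \<psi> e * indicator (S l x) e) = (\<Sum>l\<in>V. if l = h then \<psi> e else 0)"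
        by (intro sum.cong) (auto simp: indicator_def)
      then have "R x e = 0"
        using True V h(1) by (simp add: R_def)
      then show ?thesis
        using B by (auto simp: Q_def intro!: mult_nonneg_nonneg sum_nonneg)
    next
      case k: True
      then obtain k where k: "k \<in> V - {h}" "x / C < e k" by blast
      \<comment> \<open>Each \<open>S l x\<close> allows a large value only at \<open>l\<close>, but
        here both \<open>h\<close> and \<open>k\<close> are large.\<close>
      have "e \<notin> S l x" for l
        using h k by (cases "l = h") (force simp: S_def)+
      then have "\<bar>R x e\<bar> \<le> B"
        using True \<psi>_le by (simp add: R_def)
      also have "\<dots> \<le> Q x e"
      proof -
        have "1 = indicator (P h k x) e"
          using e h k by (simp add: P_def)
        also have "\<dots> \<le> (\<Sum>k\<in>V - {h}. indicator (P h k x) e :: real)"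
          using V k(1) by (intro member_le_sum) auto
        also have "\<dots> \<le> (\<Sum>h\<in>V. \<Sum>k\<in>V - {h}. indicator (P h k x) e :: real)"
          using V h(1) by (intro member_le_sum[of h V "\<lambda>h. \<Sum>k\<in>V - {h}. indicator (P h k x) e"]) (auto intro: sum_nonneg)
        finally show ?thesis
          using mult_left_mono[OF _ B, of 1] by (simp add: Q_def)
      qed
      finally show ?thesis .
    qed
  qed
  define c where "c = B * (\<Sum>h\<in>V. \<Sum>k\<in>V - {h}. 1)"
  have int_R: "integrable (law V) (R x)" for x
    unfolding R_def[abs_def] by (intro Bochner_Integration.integrable_diff Bochner_Integration.integrable_sum int_\<Phi> int_S)
  have int_Q: "integrable (law V) (Q x)" for x
    unfolding Q_def[abs_def] by (intro integrable_mult_right Bochner_Integration.integrable_sum int_P) auto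
  have integral_Q: "(\<integral>e. Q x e \<partial>law V) = c * tail (x / C) ^ 2" for x
  proof -
    have "(\<integral>e. Q x e \<partial>law V) = B * (\<integral>e. (\<Sum>h\<in>V. \<Sum>k\<in>V - {h}. indicator (P h k x) e) \<partial>law V)"
      unfolding Q_def by (rule integral_mult_right_zero)
    also have "\<dots> = B * (\<Sum>h\<in>V. (\<integral>e. (\<Sum>k\<in>V - {h}. indicator (P h k x) e) \<partial>law V))"
      by (intro arg_cong[of _ _ "(*) B"] Bochner_Integration.integral_sum Bochner_Integration.integrable_sum int_P) auto
    also have "\<dots> = B * (\<Sum>h\<in>V. \<Sum>k\<in>V - {h}. (\<integral>e. indicator (P h k x) e \<partial>law V))"
      by (intro arg_cong[of _ _ "(*) B"] sum.cong refl Bochner_Integration.integral_sum int_P) auto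
    also have "\<dots> = B * (\<Sum>h\<in>V. \<Sum>k\<in>V - {h}. tail (x / C) ^ 2)"
    proof (intro arg_cong[of _ _ "(*) B"] sum.cong refl)
      fix h k assume hk: "h \<in> V" "k \<in> V - {h}"
      have "(\<integral>e. indicator (P h k x) e \<partial>law V) = measure (law V) (P h k x \<inter> space (law V))"
        by (rule Bochner_Integration.integral_indicator)
      also have "P h k x \<inter> space (law V) = P h k x"
        by (auto simp: P_def)
      finally show "(\<integral>e. indicator (P h k x) e \<partial>law V) = tail (x / C) ^ 2"
        using law_both_exceed[OF V, of h k "x / C"] hk by (auto simp: P_def)
    qed
    finally show ?thesis
      by (simp add: c_def sum_distrib_right)
  qed
  have "((\<lambda>x. (\<integral>e. R x e \<partial>law V) / tail x) \<longlongrightarrow> 0) at_top"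
  proof (rule Lim_null_comparison)
    show "\<forall>\<^sub>F x in at_top. norm ((\<integral>e. R x e \<partial>law V) / tail x) \<le> c * tail (x / C) * (tail (x / C) / tail x)"
      using eventually_gt_at_top[of 0]
    proof eventually_elim
      case (elim x)
      have "\<bar>\<integral>e. R x e \<partial>law V\<bar> \<le> (\<integral>e. \<bar>R x e\<bar> \<partial>law V)"
        by (rule integral_abs_bound)
      also have "\<dots> \<le> (\<integral>e. Q x e \<partial>law V)"
        using R_le[OF elim] by (intro integral_mono int_Q integrable_abs int_R)
      finally show ?case
        using tail_greater_0[of x] by (simp add: integral_Q power2_eq_square divide_right_mono mult_ac)
    qed
    have "filterlim (\<lambda>x. 1 / C * x) at_top at_top"
      using C by (intro filterlim_tendsto_pos_mult_at_top[OF tendsto_const _ filterlim_ident]) simp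
    then have "((\<lambda>x. tail (x / C)) \<longlongrightarrow> 0) at_top"
      using filterlim_compose[OF tail_tendsto_0] by simp
    \<comment> \<open>One factor \<open>tail (x / C)\<close> tends to 0; the other is absorbed into
      a convergent ratio.\<close>
    then have "((\<lambda>x. c * tail (x / C) * (tail (x / C) / tail x)) \<longlongrightarrow> c * 0 * C powr \<alpha>) at_top"
      by (intro tendsto_mult tendsto_const tail_ratio_divide C)
    then show "((\<lambda>x. c * tail (x / C) * (tail (x / C) / tail x)) \<longlongrightarrow> 0) at_top"
      by simp
  qed
  moreover have "((\<lambda>x. \<Sum>h\<in>V. (\<integral>e. \<psi> e * indicator (S h x) e \<partial>law V) / tail x)
      \<longlongrightarrow> (\<Sum>h\<in>V. a h powr \<alpha> * (\<integral>y. \<psi>' h y \<partial>law (V - {h})))) at_top"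
    unfolding S_def
    by (intro tendsto_sum single_big_jump_coordinate[OF V _ \<Phi> bound C slope a \<psi> \<psi>_le \<psi>_lim])
  ultimately have "((\<lambda>x. (\<integral>e. R x e \<partial>law V) / tail x + (\<Sum>h\<in>V. (\<integral>e. \<psi> e * indicator (S h x) e \<partial>law V) / tail x))
      \<longlongrightarrow> 0 + (\<Sum>h\<in>V. a h powr \<alpha> * (\<integral>y. \<psi>' h y \<partial>law (V - {h})))) at_top"
    by (rule tendsto_add)
  moreover have "(\<integral>e. R x e \<partial>law V) / tail x + (\<Sum>h\<in>V. (\<integral>e. \<psi> e * indicator (S h x) e \<partial>law V) / tail x) =
      (\<integral>e. \<psi> e * indicator {e. x < \<Phi> e} e \<partial>law V) / tail x" for x
  proof -
    have "(\<integral>e. R x e \<partial>law V) = (\<integral>e. \<psi> e * indicator {e. x < \<Phi> e} e \<partial>law V) -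
        (\<Sum>h\<in>V. (\<integral>e. \<psi> e * indicator (S h x) e \<partial>law V))"
      unfolding R_def
      by (subst Bochner_Integration.integral_diff)
        (auto intro!: int_\<Phi> int_S Bochner_Integration.integral_sum Bochner_Integration.integrable_sum)
    then show ?thesis
      by (simp add: diff_divide_distrib sum_divide_distrib)
  qed
  ultimately show ?thesis
    by simp
qed

end

section \<open>Cdf transforms, conditional means and tail ratios\<close>

lemma (in real_distribution) integral_cdf_continuous:
  assumes "continuous_on UNIV (cdf M)"
  shows "(\<integral>x. 2 * cdf M x - 1 \<partial>M) = 0"
proof -
  interpret pair: pair_sigma_finite M M by unfold_locales
  interpret prod: pair_prob_space M M by unfold_locales
  have meas [measurable]: "cdf M \<in> borel_measurable borel"
    by (rule borel_measurable_continuous_onI[OF assms])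
  have "\<bar>cdf M x\<bar> \<le> 1" for x
    using cdf_nonneg[of x] cdf_bounded_prob[of x] by simp
  then have int: "integrable M (cdf M)"
    by (intro integrable_const_bound[where B = 1]) auto
  have right: "(\<integral>y. indicator {x..} y \<partial>M) = 1 - cdf M x" for x
  proof -
    \<comment> \<open>Continuity of the cdf excludes atoms, so including the endpoint
      \<open>x\<close> adds no mass.\<close>
    have "measure M {x} = 0"
      using assms by (simp add: isCont_cdf[symmetric] continuous_on_eq_continuous_at)
    moreover have "{x..} = space M - {..<x}" "{..x} = {..<x} \<union> {x}"
      by auto
    ultimately have "measure M {x..} = 1 - cdf M x"
      using prob_compl[of "{..<x}"] finite_measure_Union[of "{..<x}" "{x}"] by (simp add: cdf_def)
    then show ?thesis by simp
  qed
  \<comment> \<open>Integrating the indicator of \<open>x \<le> y\<close> in both orders shows that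
    \<open>cdf M\<close> and \<open>1 - cdf M\<close> have the same mean, which is therefore
    1/2.\<close>
  have "(\<integral>y. (\<integral>x. indicator {(x, y). x \<le> y} (x, y) \<partial>M) \<partial>M) =
      (\<integral>x. (\<integral>y. indicator {(x, y). x \<le> y} (x, y) \<partial>M) \<partial>M :: real)"
    by (intro pair.Fubini_integral prod.P.integrable_const_bound[where B = 1])
      (auto simp: case_prod_unfold indicator_def)
  moreover have "(\<integral>x. indicator {(x, y). x \<le> y} (x, y) \<partial>M) = cdf M y" for y
  proof -
    have "(\<lambda>x. indicator {(x, y). x \<le> y} (x, y) :: real) = indicator {..y}"
      by (auto simp: indicator_def fun_eq_iff)
    then show ?thesis by (simp add: cdf_def)
  qed
  moreover have "(\<integral>y. indicator {(x, y). x \<le> y} (x, y) \<partial>M) = 1 - cdf M x" for x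
  proof -
    have "(\<lambda>y. indicator {(x, y). x \<le> y} (x, y) :: real) = indicator {x..}"
      by (auto simp: indicator_def fun_eq_iff)
    then show ?thesis by (simp only: right)
  qed
  ultimately have "(\<integral>y. cdf M y \<partial>M) = (\<integral>x. 1 - cdf M x \<partial>M)"
    by simp
  then show ?thesis
    using int by (simp add: prob_space)
qed

text \<open>Turns the conditional mean in \<open>ctc_matrix\<close> into a quotient whose two parts
  have big-jump asymptotics.\<close>

lemma (in prob_space) integral_uniform_measure:
  fixes g :: "'a \<Rightarrow> real"
  assumes A: "A \<in> events" "0 < prob A" and g: "g \<in> borel_measurable M"
  shows "(\<integral>x. g x \<partial>uniform_measure M A) = (\<integral>x. g x * indicator A x \<partial>M) / prob A"
proof -
  have "uniform_measure M A = density M (\<lambda>x. ennreal (indicator A x / prob A))"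
    unfolding uniform_measure_def using A
    by (intro density_cong) (auto simp: indicator_def emeasure_eq_measure divide_ennreal[symmetric])
  then have "(\<integral>x. g x \<partial>uniform_measure M A) = (\<integral>x. (indicator A x / prob A) *\<^sub>R g x \<partial>M)"
    using A g by (simp only:) (rule integral_density, auto)
  also have "\<dots> = (\<integral>x. g x * indicator A x \<partial>M) / prob A"
    by (simp add: mult.commute)
  finally show ?thesis .
qed

text \<open>The ratio factors into the quotients of \<open>T\<close> by its equivalent at
  \<open>c * x\<close> and \<open>x\<close>, which tend to 1, the ratio of values of
  \<open>l\<close>, which tends to 1 by slow variation, and the exact power of
  \<open>c\<close>.\<close>

lemma regularly_varying_ratio:
  assumes l: "slowly_varying l" and T: "T \<sim>[at_top] (\<lambda>x. l x * x powr (-\<alpha>))"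
  shows "0 < c \<Longrightarrow> ((\<lambda>x. T (c * x) / T x) \<longlongrightarrow> c powr (-\<alpha>)) at_top"
    and "\<forall>\<^sub>F x in at_top. 0 < T x"
proof -
  define g where "g x = l x * x powr (-\<alpha>)" for x
  have l_pos: "\<forall>\<^sub>F x in at_top. 0 < l x"
    using l by (simp add: slowly_varying_def)
  then have g_pos: "\<forall>\<^sub>F x in at_top. 0 < g x"
    using eventually_gt_at_top[of 0] by eventually_elim (simp add: g_def)
  \<comment> \<open>Asymptotic equivalence counts 0 / 0 as 1; as \<open>g\<close> is eventually
    positive, the plain quotient has the same limit.\<close>
  have "((\<lambda>x. if T x = 0 \<and> g x = 0 then 1 else T x / g x) \<longlongrightarrow> 1) at_top"
    using asymp_equivD[OF T] unfolding g_def .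
  then have q: "((\<lambda>x. T x / g x) \<longlongrightarrow> 1) at_top"
  proof (rule Lim_transform_eventually)
    show "\<forall>\<^sub>F x in at_top. (if T x = 0 \<and> g x = 0 then 1 else T x / g x) = T x / g x"
      using g_pos by eventually_elim simp
  qed
  have "\<forall>\<^sub>F x in at_top. 0 < T x / g x"
    by (rule order_tendstoD(1)[OF q]) simp
  then show "\<forall>\<^sub>F x in at_top. 0 < T x"
    using g_pos by eventually_elim (simp add: zero_less_divide_iff)
  assume c: "0 < c"
  have c_lim: "filterlim (\<lambda>x. c * x) at_top at_top"
    by (rule filterlim_tendsto_pos_mult_at_top[OF tendsto_const c filterlim_ident])
  have "((\<lambda>x. (T (c * x) / g (c * x)) / (T x / g x) * (l (c * x) / l x) * c powr (-\<alpha>))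
      \<longlongrightarrow> 1 / 1 * 1 * c powr (-\<alpha>)) at_top"
    using l c filterlim_compose[OF q c_lim]
    by (intro tendsto_mult tendsto_divide q tendsto_const) (auto simp: slowly_varying_def)
  moreover have "\<forall>\<^sub>F x in at_top.
      (T (c * x) / g (c * x)) / (T x / g x) * (l (c * x) / l x) * c powr (-\<alpha>) = T (c * x) / T x"
    using l_pos filterlim_iff[THEN iffD1, OF c_lim, rule_format, OF l_pos] eventually_gt_at_top[of 0]
  proof eventually_elim
    case (elim x)
    have "l (c * x) / l x * c powr (-\<alpha>) = g (c * x) / g x" and nz: "g x \<noteq> 0" "g (c * x) \<noteq> 0"
      using elim c by (auto simp: g_def powr_mult)
    then have "(T (c * x) / g (c * x)) / (T x / g x) * (l (c * x) / l x) * c powr (-\<alpha>) =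
        (T (c * x) / g (c * x)) / (T x / g x) * (g (c * x) / g x)"
      by (simp only: mult.assoc)
    then show ?case
      using nz by simp
  qed
  ultimately show "((\<lambda>x. T (c * x) / T x) \<longlongrightarrow> c powr (-\<alpha>)) at_top"
    by (simp add: Lim_transform_eventually)
qed

section \<open>Tail coefficients of heavy-tailed structural causal models\<close>

context ht_hscm
begin

lemma homogeneous_scm: "homogeneous_scm {1..d} E f"
  using edges acyclic structural by unfold_locales auto

lemma noise_measurable [measurable]: "i \<in> {1..d} \<Longrightarrow> \<epsilon> i \<in> borel_measurable M"
  using noise_indep by (simp add: indep_vars_def)

lemma noise_law:
  assumes i: "i \<in> {1..d}"
  shows "regularly_varying_law (distr M borel (\<epsilon> i)) \<alpha>"
proof -
  interpret D: real_distribution "distr M borel (\<epsilon> i)"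
    using noise_measurable[OF i] by simp
  define T where "T x = prob {\<omega> \<in> space M. x < \<epsilon> i \<omega>}" for x
  have T: "measure (distr M borel (\<epsilon> i)) {x<..} = T x" for x
    using noise_measurable[OF i] by (simp add: measure_distr T_def vimage_def Int_def conj_commute)
  obtain l where l: "slowly_varying l" "T \<sim>[at_top] (\<lambda>x. l x * x powr (-\<alpha>))"
    using noise_regularly_varying i by (auto simp: T_def[abs_def])
  note ratio = regularly_varying_ratio[OF l]
  show ?thesis
  proof
    show "0 < \<alpha>" by (rule tail_index_pos)
    fix x
    \<comment> \<open>The asymptotics give positivity only for large arguments; monotonicity of the
      tail extends it to all.\<close>
    obtain z where "\<And>y. z \<le> y \<Longrightarrow> 0 < T y"
      using ratio(2) by (auto simp: eventually_at_top_linorder)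
    then have "0 < T (max x z)"
      by simp
    also have "\<dots> \<le> T x"
      unfolding T[symmetric] by (rule D.finite_measure_mono) auto
    finally show "0 < measure (distr M borel (\<epsilon> i)) {x<..}"
      by (simp add: T)
  qed (simp add: T ratio)
qed

text \<open>Independence gives the product of the marginals, and identical distribution lets the law
  of a single \<open>\<epsilon> i\<close> stand for every factor.\<close>

lemma noise_vector_law:
  assumes i: "i \<in> {1..d}"
  shows "distr M (\<Pi>\<^sub>M k\<in>{1..d}. borel) (\<lambda>\<omega>. \<lambda>k\<in>{1..d}. \<epsilon> k \<omega>) = (\<Pi>\<^sub>M k\<in>{1..d}. distr M borel (\<epsilon> i))"
proof -
  have "distr M (\<Pi>\<^sub>M k\<in>{1..d}. borel) (\<lambda>\<omega>. \<lambda>k\<in>{1..d}. \<epsilon> k \<omega>) = (\<Pi>\<^sub>M k\<in>{1..d}. distr M borel (\<epsilon> k))"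
  proof (rule indep_vars_iff_distr_eq_PiM'[THEN iffD1, OF _ _ noise_indep])
    show "{1..d} \<noteq> {}" using i by blast
  qed (rule noise_measurable)
  also have "\<dots> = (\<Pi>\<^sub>M k\<in>{1..d}. distr M borel (\<epsilon> i))"
    by (intro PiM_cong refl noise_ident i)
  finally show ?thesis .
qed

lemma X_eq_response:
  assumes "i \<in> {1..d}" "\<omega> \<in> space M"
  shows "X i \<omega> = homogeneous_scm.response {1..d} E f i (\<lambda>k\<in>{1..d}. \<epsilon> k \<omega>)"
proof -
  interpret S: homogeneous_scm "{1..d}" E f by (rule homogeneous_scm)
  have "X i \<omega> = composite E f i (\<lambda>k. \<epsilon> k \<omega>)"
    by (rule X_eq_composite[OF assms])
  also have "\<dots> = S.response i (\<lambda>k. \<epsilon> k \<omega>)"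
    using assms noise_nonneg by (intro S.response_eq_composite[symmetric])
  also have "\<dots> = S.response i (\<lambda>k\<in>{1..d}. \<epsilon> k \<omega>)"
    using S.Ancestors_subset[OF assms(1)] by (intro S.response_cong[OF assms(1)]) auto
  finally show ?thesis .
qed

text \<open>The probability of the conditioning event and the integral over it are both compared
  with the noise tail; that tail cancels in their quotient.\<close>

lemma ctc_matrix_eq:
  assumes i: "i \<in> {1..d}" and j: "j \<in> {1..d}"
  shows "ctc_matrix M X i j =
    (\<Sum>h\<in>Ancestors E i \<inter> Ancestors E j. air_matrix E f h i powr \<alpha>) /
    (\<Sum>h\<in>Ancestors E i. air_matrix E f h i powr \<alpha>)"
proof -
  let ?V = "{1..d}" and ?a = "\<lambda>h. air_matrix E f h i"
  interpret S: homogeneous_scm ?V E f by (rule homogeneous_scm)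
  interpret L: regularly_varying_law "distr M borel (\<epsilon> i)" \<alpha> by (rule noise_law[OF i])
  interpret Xj: real_distribution "distr M borel (X j)"
    using X_measurable[OF j] by simp
  define G where "G = cdf (distr M borel (X j))"
  define \<psi> where "\<psi> e = 2 * G (S.response j e) - 1" for e
  note [measurable] = S.response_measurable[OF i] S.response_measurable[OF j]
    X_measurable[OF i] X_measurable[OF j]
  have [measurable]: "G \<in> borel_measurable borel"
    unfolding G_def by (rule borel_measurable_continuous_onI[OF X_continuous[OF j]])
  have \<psi> [measurable]: "\<psi> \<in> borel_measurable (\<Pi>\<^sub>M k\<in>?V. borel)"
    unfolding \<psi>_def[abs_def] by measurable
  have \<psi>_le: "\<bar>\<psi> e\<bar> \<le> 1" for e
    using Xj.cdf_nonneg[of "S.response j e"] Xj.cdf_bounded_prob[of "S.response j e"]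
    by (simp add: \<psi>_def G_def abs_le_iff)
  have vec: "(\<lambda>\<omega>. \<lambda>k\<in>?V. \<epsilon> k \<omega>) \<in> measurable M (\<Pi>\<^sub>M k\<in>?V. borel)"
    by (rule measurable_restrict) (rule noise_measurable)
  have integral_vec: "(\<integral>\<omega>. g (\<lambda>k\<in>?V. \<epsilon> k \<omega>) \<partial>M) = (\<integral>e. g e \<partial>L.law ?V)"
    if "g \<in> borel_measurable (\<Pi>\<^sub>M k\<in>?V. borel)" for g :: "(nat \<Rightarrow> real) \<Rightarrow> real"
    unfolding noise_vector_law[OF i, symmetric] by (rule integral_distr[OF vec that, symmetric])
  have tail_sum: "(\<Sum>h\<in>?V. ?a h powr \<alpha> * (if h \<in> B then 1 else 0)) = (\<Sum>h\<in>Ancestors E i \<inter> B. ?a h powr \<alpha>)" for B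
    using S.Ancestors_subset[OF i]
    by (intro sum.mono_neutral_cong_right) (auto simp: air_matrix_def)
  obtain C where C: "0 < C"
    "\<And>e x. 0 < x \<Longrightarrow> (\<And>k. k \<in> ?V \<Longrightarrow> e k \<le> x) \<Longrightarrow> S.response i e \<le> C * x"
    using S.response_bounded_on_box[OF i] by blast
  have centred: "(\<integral>e. \<psi> e \<partial>L.law ?V) = 0"
  proof -
    have "(\<integral>e. \<psi> e \<partial>L.law ?V) = (\<integral>\<omega>. 2 * G (X j \<omega>) - 1 \<partial>M)"
      unfolding integral_vec[OF \<psi>, symmetric]
      by (intro Bochner_Integration.integral_cong) (simp_all add: \<psi>_def X_eq_response[OF j])
    also have "\<dots> = (\<integral>x. 2 * G x - 1 \<partial>distr M borel (X j))"
      by (rule integral_distr[symmetric]) measurable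
    also have "\<dots> = 0"
      unfolding G_def by (rule Xj.integral_cdf_continuous[OF X_continuous[OF j]])
    finally show ?thesis .
  qed
  have \<psi>_const: "\<psi> (y(h := t)) = \<psi> y" if "h \<notin> Ancestors E j" for h y t
    unfolding \<psi>_def using that by (subst S.response_cong[OF j, of "y(h := t)" y]) auto
  define \<psi>' where "\<psi>' h y = (if h \<in> Ancestors E j then 1 else \<psi> y)" for h y
  have \<psi>_lim: "((\<lambda>t. \<psi> (y(h := t))) \<longlongrightarrow> \<psi>' h y) at_top" if h: "h \<in> ?V" for h y
  proof (cases "h \<in> Ancestors E j")
    case True
    \<comment> \<open>The response divided by \<open>t\<close> tends to a positive AIR entry, so the
      response itself diverges and its cdf value tends to 1.\<close>
    have lim: "filterlim (\<lambda>t. S.response j (y(h := t)) / t * t) at_top at_top"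
      by (rule filterlim_tendsto_pos_mult_at_top[OF S.response_asymptotic[OF j h]
        S.air_matrix_pos[OF j True] filterlim_ident])
    have "\<forall>\<^sub>F t in at_top. S.response j (y(h := t)) / t * t = S.response j (y(h := t))"
      using eventually_gt_at_top[of 0] by eventually_elim simp
    then have "filterlim (\<lambda>t. S.response j (y(h := t))) at_top at_top"
      by (rule filterlim_cong[OF refl refl, THEN iffD1, OF _ lim])
    then have "((\<lambda>t. G (S.response j (y(h := t)))) \<longlongrightarrow> 1) at_top"
      unfolding G_def by (rule filterlim_compose[OF Xj.cdf_lim_at_top_prob])
    then have "((\<lambda>t. \<psi> (y(h := t))) \<longlongrightarrow> 2 * 1 - 1) at_top"
      unfolding \<psi>_def by (intro tendsto_intros)
    then show ?thesis
      using True by (simp add: \<psi>'_def)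
  next
    case False
    then show ?thesis
      by (simp add: \<psi>'_def \<psi>_const)
  qed
  have \<psi>'_integral: "(\<integral>y. \<psi>' h y \<partial>L.law (?V - {h})) = (if h \<in> Ancestors E j then 1 else 0)"
    if h: "h \<in> ?V" for h
  proof (cases "h \<in> Ancestors E j")
    case True
    show ?thesis
      unfolding \<psi>'_def if_P[OF True] by (rule L.integral_law_const)
  next
    case False
    \<comment> \<open>\<open>\<psi>\<close> ignores coordinate \<open>h\<close>, so integrating that
      coordinate out changes nothing and the mean stays 0.\<close>
    have "(\<integral>e. \<psi> e \<partial>L.law ?V) = (\<integral>y. \<psi> y \<partial>L.law (?V - {h}))"
      using h False \<psi>_const L.prob_space
      by (subst L.integral_law_update[OF _ h \<psi> \<psi>_le]) simp_all
    then show ?thesis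
      using False centred by (simp add: \<psi>'_def)
  qed
  let ?num = "\<Sum>h\<in>Ancestors E i \<inter> Ancestors E j. ?a h powr \<alpha>"
  let ?den = "\<Sum>h\<in>Ancestors E i. ?a h powr \<alpha>"
  let ?ind = "\<lambda>x \<omega>. indicator {\<omega> \<in> space M. x < X i \<omega>} \<omega> :: real"
  have jump: "((\<lambda>x. (\<integral>e. \<phi> e * indicator {e. x < S.response i e} e \<partial>L.law ?V) / L.tail x)
      \<longlongrightarrow> (\<Sum>h\<in>?V. ?a h powr \<alpha> * (\<integral>y. \<phi>' h y \<partial>L.law (?V - {h})))) at_top"
    if \<phi>: "\<phi> \<in> borel_measurable (\<Pi>\<^sub>M k\<in>?V. borel)" "\<And>e. \<bar>\<phi> e\<bar> \<le> 1"
      "\<And>h y. h \<in> ?V \<Longrightarrow> ((\<lambda>t. \<phi> (y(h := t))) \<longlongrightarrow> \<phi>' h y) at_top" for \<phi> \<phi>'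
  proof (rule L.single_big_jump[OF finite_atLeastAtMost S.response_measurable[OF i] _ C(1)])
    show "S.response i e \<le> C * x" if "0 < x" "\<And>k. k \<in> ?V \<Longrightarrow> e k \<le> x" for e x
      by (rule C(2)[OF that])
  qed (rule \<phi> S.response_asymptotic[OF i] S.air_matrix_nonneg[OF i] | assumption)+
  have "((\<lambda>x. (\<integral>e. \<psi> e * indicator {e. x < S.response i e} e \<partial>L.law ?V) / L.tail x)
      \<longlongrightarrow> (\<Sum>h\<in>?V. ?a h powr \<alpha> * (\<integral>y. \<psi>' h y \<partial>L.law (?V - {h})))) at_top"
    by (rule jump[OF \<psi> \<psi>_le \<psi>_lim])
  moreover have "(\<Sum>h\<in>?V. ?a h powr \<alpha> * (\<integral>y. \<psi>' h y \<partial>L.law (?V - {h}))) = ?num"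
    using \<psi>'_integral tail_sum[of "Ancestors E j"] by simp
  moreover have "(\<integral>e. \<psi> e * indicator {e. x < S.response i e} e \<partial>L.law ?V) =
      (\<integral>\<omega>. (2 * G (X j \<omega>) - 1) * ?ind x \<omega> \<partial>M)" for x
    by (subst integral_vec[symmetric], measurable)
      (intro Bochner_Integration.integral_cong, auto simp: \<psi>_def X_eq_response[OF j] X_eq_response[OF i] indicator_def)
  ultimately have num: "((\<lambda>x. (\<integral>\<omega>. (2 * G (X j \<omega>) - 1) * ?ind x \<omega> \<partial>M) / L.tail x) \<longlongrightarrow> ?num) at_top"
    by simp
  have "((\<lambda>x. (\<integral>e. 1 * indicator {e. x < S.response i e} e \<partial>L.law ?V) / L.tail x)
      \<longlongrightarrow> (\<Sum>h\<in>?V. ?a h powr \<alpha> * (\<integral>y. 1 \<partial>L.law (?V - {h})))) at_top"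
    by (rule jump) auto
  moreover have "(\<Sum>h\<in>?V. ?a h powr \<alpha> * (\<integral>y. 1 \<partial>L.law (?V - {h}))) = ?den"
    unfolding L.integral_law_const using tail_sum[of UNIV] by simp
  moreover have "(\<integral>e. 1 * indicator {e. x < S.response i e} e \<partial>L.law ?V) = prob {\<omega> \<in> space M. x < X i \<omega>}" for x
  proof -
    have "(\<integral>e. 1 * indicator {e. x < S.response i e} e \<partial>L.law ?V) = (\<integral>\<omega>. ?ind x \<omega> \<partial>M)"
      by (subst integral_vec[symmetric], measurable)
        (intro Bochner_Integration.integral_cong, auto simp: X_eq_response[OF i] indicator_def)
    also have "\<dots> = prob ({\<omega> \<in> space M. x < X i \<omega>} \<inter> space M)"
      by (rule Bochner_Integration.integral_indicator)
    also have "{\<omega> \<in> space M. x < X i \<omega>} \<inter> space M = {\<omega> \<in> space M. x < X i \<omega>}"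
      by auto
    finally show ?thesis .
  qed
  ultimately have den: "((\<lambda>x. prob {\<omega> \<in> space M. x < X i \<omega>} / L.tail x) \<longlongrightarrow> ?den) at_top"
    by simp
  have den_pos: "0 < ?den"
    by (rule S.air_matrix_powr_sum_pos[OF i])
  have "((\<lambda>x. ((\<integral>\<omega>. (2 * G (X j \<omega>) - 1) * ?ind x \<omega> \<partial>M) / L.tail x) /
      (prob {\<omega> \<in> space M. x < X i \<omega>} / L.tail x)) \<longlongrightarrow> ?num / ?den) at_top"
    using den_pos by (intro tendsto_divide num den) simp
  moreover have "\<forall>\<^sub>F x in at_top.
      ((\<integral>\<omega>. (2 * G (X j \<omega>) - 1) * ?ind x \<omega> \<partial>M) / L.tail x) / (prob {\<omega> \<in> space M. x < X i \<omega>} / L.tail x) =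
      (\<integral>\<omega>. 2 * G (X j \<omega>) - 1 \<partial>uniform_measure M {\<omega> \<in> space M. x < X i \<omega>})"
    using order_tendstoD(1)[OF den den_pos]
  proof eventually_elim
    case (elim x)
    then have "0 < prob {\<omega> \<in> space M. x < X i \<omega>}"
      using L.tail_greater_0[of x] by (simp add: zero_less_divide_iff)
    then have "(\<integral>\<omega>. 2 * G (X j \<omega>) - 1 \<partial>uniform_measure M {\<omega> \<in> space M. x < X i \<omega>}) =
        (\<integral>\<omega>. (2 * G (X j \<omega>) - 1) * ?ind x \<omega> \<partial>M) / prob {\<omega> \<in> space M. x < X i \<omega>}"
      by (intro integral_uniform_measure) measurable
    then show ?case
      using L.tail_greater_0[of x] by simp
  qed
  ultimately have "((\<lambda>x. \<integral>\<omega>. 2 * G (X j \<omega>) - 1 \<partial>uniform_measure M {\<omega> \<in> space M. x < X i \<omega>})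
      \<longlongrightarrow> ?num / ?den) at_top"
    by (rule Lim_transform_eventually)
  then show ?thesis
    unfolding ctc_matrix_def G_def by (intro tendsto_Lim) simp_all
qed

text \<open>The \<alpha>-th powers of the standardized entries are the ancestors' shares of the
  total jump weight, which is the form the combinatorial argument requires.\<close>

lemma ctc_common_ancestor_matrix:
  "common_ancestor_matrix d E (\<lambda>h i. std_air_matrix E f \<alpha> h i powr \<alpha>) (ctc_matrix M X)"
proof -
  interpret S: homogeneous_scm "{1..d}" E f by (rule homogeneous_scm)
  note pos = S.air_matrix_powr_sum_pos[of _ \<alpha>]
  show ?thesis
  proof
    show "E \<subseteq> {1..d} \<times> {1..d}" "acyclic E" by (fact edges acyclic)+
    fix i assume i: "i \<in> {1..d}"
    note std = S.std_air_matrix_powr[OF i tail_index_pos]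
    show "0 < std_air_matrix E f \<alpha> h i powr \<alpha>" if "h \<in> Ancestors E i" for h
      using pos[OF i] S.air_matrix_pos[OF i that] by (simp add: std)
    show "std_air_matrix E f \<alpha> h i powr \<alpha> = 0" if "h \<notin> Ancestors E i" for h
      using that by (simp add: std_air_matrix_def air_matrix_def)
    show "(\<Sum>h\<in>Ancestors E i. std_air_matrix E f \<alpha> h i powr \<alpha>) = 1"
      using pos[OF i] by (simp add: std sum_divide_distrib[symmetric])
    show "ctc_matrix M X i j = (\<Sum>h\<in>Ancestors E i \<inter> Ancestors E j. std_air_matrix E f \<alpha> h i powr \<alpha>)"
      if "j \<in> {1..d}" for j
      using ctc_matrix_eq[OF i that] by (simp add: std sum_divide_distrib)
  qed
qed

end

theorem proposition10:
  fixes M :: "'a measure" and d :: nat and E :: "(nat \<times> nat) set"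
    and f :: "nat \<Rightarrow> (nat \<Rightarrow> real) \<Rightarrow> real" and \<epsilon> X :: "nat \<Rightarrow> 'a \<Rightarrow> real" and \<alpha> :: real
    and enum :: "nat \<Rightarrow> nat list" and A0 :: "nat \<Rightarrow> nat \<Rightarrow> real"
  assumes "ht_hscm M d E f \<epsilon> X \<alpha>"
    and "level_enumeration d (ctc_matrix M X) enum"
  shows "\<forall>j\<in>{1..d}. \<forall>i\<in>{1..d}.
    air_algorithm d enum A0 (ctc_matrix M X) j i = std_air_matrix E f \<alpha> j i powr \<alpha> \<and>
    std_air_matrix E f \<alpha> j i = air_algorithm d enum A0 (ctc_matrix M X) j i powr (1 / \<alpha>) \<and>
    (\<alpha> = 1 \<longrightarrow> air_algorithm d enum A0 (ctc_matrix M X) j i = std_air_matrix E f \<alpha> j i)"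
proof (intro ballI)
  fix j i assume ij: "j \<in> {1..d}" "i \<in> {1..d}"
  interpret ht_hscm M d E f \<epsilon> X \<alpha> by fact
  interpret S: homogeneous_scm "{1..d}" E f by (rule homogeneous_scm)
  have "air_algorithm d enum A0 (ctc_matrix M X) j i = std_air_matrix E f \<alpha> j i powr \<alpha>"
    by (rule common_ancestor_matrix.air_algorithm_correct[OF ctc_common_ancestor_matrix assms(2) ij(2,1)])
  \<comment> \<open>Nonnegativity lets the \<alpha>-th root undo the \<alpha>-th power, and for
    \<alpha> = 1 makes the power equal to the entry.\<close>
  moreover have "0 \<le> std_air_matrix E f \<alpha> j i"
    using S.air_matrix_nonneg[OF ij(2)] by (simp add: std_air_matrix_def)
  ultimately show "air_algorithm d enum A0 (ctc_matrix M X) j i = std_air_matrix E f \<alpha> j i powr \<alpha> \<and>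
      std_air_matrix E f \<alpha> j i = air_algorithm d enum A0 (ctc_matrix M X) j i powr (1 / \<alpha>) \<and>
      (\<alpha> = 1 \<longrightarrow> air_algorithm d enum A0 (ctc_matrix M X) j i = std_air_matrix E f \<alpha> j i)"
    using tail_index_pos by (auto simp: powr_powr)
qed

end
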